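(* Let $\Gamma$ be a finite connected simple graph. A subcomplex $K\subset UD_2(\Gamma)$ is a standard product subcomplex if and only if there is a pair of disjoint connected subgraphs $\Gamma_1,\Gamma_2$ of $\Gamma$ without leaves (each having at least one edge) such that $K=\Gamma_1\mathbin{\mathring{\times}}\Gamma_2$. In particular, every standard product subcomplex of $UD_2(\Gamma)$ is embedded. Consequently, a subcomplex $K$ is a maximal product subcomplex of $UD_2(\Gamma)$ if and only if it is a standard product subcomplex, $K=\Gamma_1\mathbin{\mathring{\times}}\Gamma_2$ with $\Gamma_1,\Gamma_2$ disjoint connected subgraphs of $\Gamma$ without leaves (each having at least one edge), and there exists no pair of disjoint connected subgraphs $\Gamma_1',\Gamma_2'$ of $\Gamma$ without leaves such that $\Gamma_i\subset\Gamma_i'$ for $i=1,2$, with at least one inclusion being proper.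
   Context: Graphs are regarded as $1$-dimensional cube complexes; graphs and subgraphs are connected and have at least one edge. A leaf is a vertex of valency $1$. The unordered discrete $2$-configuration space $UD_2(\Gamma)$ is the square complex whose cells are the unordered pairs $\{\sigma_1,\sigma_2\}$ of disjoint closed cells (vertices or edges) of $\Gamma$, the cell $\{\sigma_1,\sigma_2\}$ being identified with $\sigma_1\times\sigma_2$ up to order. It is a compact special (in particular non-positively curved) square complex. For disjoint subgraphs $\Gamma_1,\Gamma_2\subset\Gamma$, $\Gamma_1\mathbin{\mathring{\times}}\Gamma_2\subset UD_2(\Gamma)$ denotes the image of the canonical inclusion $\Gamma_1\times\Gamma_2\hookrightarrow UD_2(\Gamma)$, $(x,y)\mapsto\{x,y\}$. For a non-positively curved square complex $Y$, a combinatorial map $\phi: X\to Y$ from a non-positively curved cube complex (cells map homeomorphically to cells) is a local isometry if for each vertex the induced map on links is injective with image an induced (full) subcomplex. A product structure is a local isometry $\iota:\Delta_1\times\Delta_2\to Y$ from a product of two graphs such that for some vertices $v_i\in\Delta_i$, $\iota$ restricts to isomorphisms from $\Delta_1\times\{v_2\}$ and from $\{v_1\}\times\Delta_2$ onto their images. It is standard if $\Delta_1$ and $\Delta_2$ have no leaves. A standard product subcomplex of $Y$ is the image of a standard product structure; it is embedded if the product structure $\iota$ is injective. A maximal product subcomplex is a standard product subcomplex maximal with respect to inclusion among standard product subcomplexes. *)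

theory Defs
  imports "Graph_Theory.Graph_Theory" "HOL-Library.Uprod"
begin

section \<open>Graphs and square complexes\<close>

text \<open>
  A graph, regarded as a one-dimensional cube complex, is a digraph of oriented edges together with
  the orientation reversal; loops and multiple edges are allowed.  An edge of the complex is a pair
  of mutually reverse arcs.
\<close>

record ('v, 'e) cgraph =
  dg :: "('v, 'e) pre_digraph"
  erev :: "'e \<Rightarrow> 'e"

definition cube_graph :: "('v, 'e, 'm) cgraph_scheme \<Rightarrow> bool" where
  "cube_graph G \<longleftrightarrow> bidirected_digraph (dg G) (erev G) \<and> connected (dg G) \<and> arcs (dg G) \<noteq> {}"

text \<open>The valency of a vertex is its number of outgoing arcs, so that a loop counts twice.\<close>

definition leafless :: "('v, 'e, 'm) cgraph_scheme \<Rightarrow> bool" where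
  "leafless G \<longleftrightarrow> (\<forall>v \<in> verts (dg G). out_degree (dg G) v \<noteq> 1)"

text \<open>
  A square complex consists of its one-skeleton and of parametrised squares \<open>s : [0,1]\<^sup>2 \<rightarrow> X\<close>.
  Every closed \<open>2\<close>-cell is listed with its eight parametrisations, on which the symmetry group of
  the square acts freely; the action is generated by
    \<open>sflip X s = (\<lambda>(x,y). s (1 - x, y))\<close>  and  \<open>stransp X s = (\<lambda>(x,y). s (y, x))\<close>.
  The oriented edge \<open>bottom X s\<close> is \<open>x \<mapsto> s (x, 0)\<close>, and \<open>left_side X s\<close> is \<open>y \<mapsto> s (0, y)\<close>.
  The other two sides are obtained from these by symmetry.
\<close>

record ('v, 'e, 's) sqcomplex = "('v, 'e) cgraph" +
  squares :: "'s set"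
  bottom :: "'s \<Rightarrow> 'e"
  sflip :: "'s \<Rightarrow> 's"
  stransp :: "'s \<Rightarrow> 's"

definition left_side :: "('v, 'e, 's) sqcomplex \<Rightarrow> 's \<Rightarrow> 'e" where
  "left_side X s = bottom X (stransp X s)"

locale square_complex =
  fixes X :: "('v, 'e, 's) sqcomplex"
  assumes skeleton: "bidirected_digraph (dg X) (erev X)"
    and bottom_in: "s \<in> squares X \<Longrightarrow> bottom X s \<in> arcs (dg X)"
    and sflip_in: "s \<in> squares X \<Longrightarrow> sflip X s \<in> squares X"
    and stransp_in: "s \<in> squares X \<Longrightarrow> stransp X s \<in> squares X"
    and sflip_sflip: "s \<in> squares X \<Longrightarrow> sflip X (sflip X s) = s"
    and stransp_stransp: "s \<in> squares X \<Longrightarrow> stransp X (stransp X s) = s"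
    and braid: "s \<in> squares X \<Longrightarrow>
      sflip X (stransp X (sflip X (stransp X s))) = stransp X (sflip X (stransp X (sflip X s)))"
    \<comment> \<open>Freeness: all remaining cases follow from these two and from \<open>erev X e \<noteq> e\<close>.\<close>
    and stransp_free: "s \<in> squares X \<Longrightarrow> stransp X s \<noteq> s"
    and half_turn_free: "s \<in> squares X \<Longrightarrow> sflip X (stransp X (sflip X (stransp X s))) \<noteq> s"
    and bottom_sflip: "s \<in> squares X \<Longrightarrow> bottom X (sflip X s) = erev X (bottom X s)"
    and tail_left_side: "s \<in> squares X \<Longrightarrow> tail (dg X) (left_side X s) = tail (dg X) (bottom X s)"

text \<open>
  The link of \<open>v\<close> has the arcs issuing from \<open>v\<close> as its vertices.  Its edges are the corners of
  squares at \<open>v\<close>: a parametrised square \<open>s\<close> with \<open>s (0,0) = v\<close> gives an edge joining \<open>bottom X s\<close> and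
  \<open>left_side X s\<close>, and \<open>s\<close>, \<open>stransp X s\<close> give the same edge.
\<close>

definition corners :: "('v, 'e, 's) sqcomplex \<Rightarrow> 'v \<Rightarrow> 's set" where
  "corners X v = {s \<in> squares X. tail (dg X) (bottom X s) = v}"

text \<open>
  Non-positive curvature: all links are flag simplicial complexes.  As there are no cubes of
  dimension three, this means that the links have no loops, no double edges and no triangles.
\<close>

definition npc_square_complex :: "('v, 'e, 's) sqcomplex \<Rightarrow> bool" where
  "npc_square_complex X \<longleftrightarrow> square_complex X \<and>
    (\<forall>v \<in> verts (dg X).
      (\<forall>s \<in> corners X v. bottom X s \<noteq> left_side X s) \<and>
      (\<forall>s \<in> corners X v. \<forall>t \<in> corners X v.
        bottom X s = bottom X t \<and> left_side X s = left_side X t \<longrightarrow> s = t) \<and>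
      \<not> (\<exists>s \<in> corners X v. \<exists>t \<in> corners X v. \<exists>u \<in> corners X v.
        left_side X s = bottom X t \<and> left_side X t = bottom X u \<and> left_side X u = bottom X s))"

text \<open>
  Subcomplexes are sets of (parametrised) cells which are closed under faces and
  reparametrisation; inclusion of subcomplexes is inclusion of sets.
\<close>

datatype ('v, 'e, 's) cell = Vertex 'v | Edge 'e | Square 's

definition cells :: "('v, 'e, 's) sqcomplex \<Rightarrow> ('v, 'e, 's) cell set" where
  "cells X = Vertex ` verts (dg X) \<union> Edge ` arcs (dg X) \<union> Square ` squares X"

definition subcomplex :: "('v, 'e, 's) cell set \<Rightarrow> ('v, 'e, 's) sqcomplex \<Rightarrow> bool" where
  "subcomplex K X \<longleftrightarrow> K \<subseteq> cells X \<and>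
    (\<forall>e. Edge e \<in> K \<longrightarrow> Vertex (tail (dg X) e) \<in> K \<and> Edge (erev X e) \<in> K) \<and>
    (\<forall>s. Square s \<in> K \<longrightarrow>
      Edge (bottom X s) \<in> K \<and> Square (sflip X s) \<in> K \<and> Square (stransp X s) \<in> K)"

section \<open>Combinatorial maps and local isometries\<close>

record ('v, 'e, 's, 'v1, 'e1, 's1) sqmap =
  on_verts :: "'v \<Rightarrow> 'v1"
  on_edges :: "'e \<Rightarrow> 'e1"
  on_squares :: "'s \<Rightarrow> 's1"

definition on_cells ::
  "('v, 'e, 's, 'v1, 'e1, 's1) sqmap \<Rightarrow> ('v, 'e, 's) cell \<Rightarrow> ('v1, 'e1, 's1) cell" where
  "on_cells \<phi> = map_cell (on_verts \<phi>) (on_edges \<phi>) (on_squares \<phi>)"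

definition combinatorial_map ::
  "('v, 'e, 's) sqcomplex \<Rightarrow> ('v1, 'e1, 's1) sqcomplex \<Rightarrow> ('v, 'e, 's, 'v1, 'e1, 's1) sqmap \<Rightarrow> bool"
  where
  "combinatorial_map X Y \<phi> \<longleftrightarrow>
    (\<forall>v \<in> verts (dg X). on_verts \<phi> v \<in> verts (dg Y)) \<and>
    (\<forall>e \<in> arcs (dg X). on_edges \<phi> e \<in> arcs (dg Y) \<and>
      tail (dg Y) (on_edges \<phi> e) = on_verts \<phi> (tail (dg X) e) \<and>
      on_edges \<phi> (erev X e) = erev Y (on_edges \<phi> e)) \<and>
    (\<forall>s \<in> squares X. on_squares \<phi> s \<in> squares Y \<and>
      bottom Y (on_squares \<phi> s) = on_edges \<phi> (bottom X s) \<and>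
      on_squares \<phi> (sflip X s) = sflip Y (on_squares \<phi> s) \<and>
      on_squares \<phi> (stransp X s) = stransp Y (on_squares \<phi> s))"

text \<open>
  At each vertex the map of links is injective, and each edge of the link in \<open>Y\<close> whose two
  endpoints lie in the image is itself in the image.
\<close>

definition local_isometry ::
  "('v, 'e, 's) sqcomplex \<Rightarrow> ('v1, 'e1, 's1) sqcomplex \<Rightarrow> ('v, 'e, 's, 'v1, 'e1, 's1) sqmap \<Rightarrow> bool"
  where
  "local_isometry X Y \<phi> \<longleftrightarrow>
    npc_square_complex X \<and> npc_square_complex Y \<and> combinatorial_map X Y \<phi> \<and>
    (\<forall>v \<in> verts (dg X).
      inj_on (on_edges \<phi>) (out_arcs (dg X) v) \<and> inj_on (on_squares \<phi>) (corners X v) \<and>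
      (\<forall>t \<in> corners Y (on_verts \<phi> v).
        bottom Y t \<in> on_edges \<phi> ` out_arcs (dg X) v \<and>
        left_side Y t \<in> on_edges \<phi> ` out_arcs (dg X) v \<longrightarrow>
        t \<in> on_squares \<phi> ` corners X v))"

section \<open>Products of graphs and product subcomplexes\<close>

text \<open>
  The arc \<open>Inl (e, w)\<close> is \<open>e \<times> {w}\<close>, and \<open>Inr (v, d)\<close> is \<open>{v} \<times> d\<close>.  The square \<open>Inl (e, d)\<close> is
  \<open>(x,y) \<mapsto> (e x, d y)\<close>, and \<open>Inr (d, e)\<close> is its transpose \<open>(x,y) \<mapsto> (e y, d x)\<close>.
\<close>

definition product_skeleton ::
  "('v, 'e) pre_digraph \<Rightarrow> ('w, 'd) pre_digraph \<Rightarrow> ('v \<times> 'w, 'e \<times> 'w + 'v \<times> 'd) pre_digraph" where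
  "product_skeleton G H = \<lparr>
     verts = verts G \<times> verts H,
     arcs = (arcs G \<times> verts H) <+> (verts G \<times> arcs H),
     tail = case_sum (\<lambda>(e, w). (tail G e, w)) (\<lambda>(v, d). (v, tail H d)),
     head = case_sum (\<lambda>(e, w). (head G e, w)) (\<lambda>(v, d). (v, head H d)) \<rparr>"

definition product_complex ::
  "('v, 'e) cgraph \<Rightarrow> ('w, 'd) cgraph \<Rightarrow>
   ('v \<times> 'w, 'e \<times> 'w + 'v \<times> 'd, 'e \<times> 'd + 'd \<times> 'e) sqcomplex" where
  "product_complex G H = \<lparr>
     dg = product_skeleton (dg G) (dg H),
     erev = perm_restrict (map_sum (map_prod (erev G) id) (map_prod id (erev H)))
       (arcs (product_skeleton (dg G) (dg H))),
     squares = (arcs (dg G) \<times> arcs (dg H)) <+> (arcs (dg H) \<times> arcs (dg G)),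
     bottom = case_sum (\<lambda>(e, d). Inl (e, tail (dg H) d)) (\<lambda>(d, e). Inr (tail (dg G) e, d)),
     sflip = map_sum (map_prod (erev G) id) (map_prod (erev H) id),
     stransp = case_sum (\<lambda>(e, d). Inr (d, e)) (\<lambda>(d, e). Inl (e, d)) \<rparr>"

definition first_slice ::
  "('v, 'e) cgraph \<Rightarrow> 'w \<Rightarrow> ('v \<times> 'w, 'e \<times> 'w + 'v \<times> 'd, 'e \<times> 'd + 'd \<times> 'e) cell set" where
  "first_slice G w =
     (\<lambda>v. Vertex (v, w)) ` verts (dg G) \<union> (\<lambda>e. Edge (Inl (e, w))) ` arcs (dg G)"

definition second_slice ::
  "'v \<Rightarrow> ('w, 'd) cgraph \<Rightarrow> ('v \<times> 'w, 'e \<times> 'w + 'v \<times> 'd, 'e \<times> 'd + 'd \<times> 'e) cell set" where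
  "second_slice v H =
     (\<lambda>w. Vertex (v, w)) ` verts (dg H) \<union> (\<lambda>d. Edge (Inr (v, d))) ` arcs (dg H)"

text \<open>An injective combinatorial map is an isomorphism onto its image.\<close>

definition product_structure ::
  "('v, 'e) cgraph \<Rightarrow> ('w, 'd) cgraph \<Rightarrow> ('v1, 'e1, 's1) sqcomplex \<Rightarrow>
   ('v \<times> 'w, 'e \<times> 'w + 'v \<times> 'd, 'e \<times> 'd + 'd \<times> 'e, 'v1, 'e1, 's1) sqmap \<Rightarrow> bool" where
  "product_structure G H Y \<iota> \<longleftrightarrow>
    cube_graph G \<and> cube_graph H \<and> local_isometry (product_complex G H) Y \<iota> \<and>
    (\<exists>v \<in> verts (dg G). \<exists>w \<in> verts (dg H).
      inj_on (on_cells \<iota>) (first_slice G w) \<and> inj_on (on_cells \<iota>) (second_slice v H))"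

definition standard_product_structure ::
  "('v, 'e) cgraph \<Rightarrow> ('w, 'd) cgraph \<Rightarrow> ('v1, 'e1, 's1) sqcomplex \<Rightarrow>
   ('v \<times> 'w, 'e \<times> 'w + 'v \<times> 'd, 'e \<times> 'd + 'd \<times> 'e, 'v1, 'e1, 's1) sqmap \<Rightarrow> bool" where
  "standard_product_structure G H Y \<iota> \<longleftrightarrow> product_structure G H Y \<iota> \<and> leafless G \<and> leafless H"

text \<open>
  The factors of a product structure embed in \<open>Y\<close> via the slices, so nothing is lost by
  letting them have vertices and arcs in the types of those of \<open>Y\<close>: see
  \<open>standard_product_structure_retype\<close> below.
\<close>

definition standard_product_subcomplex ::
  "('v, 'e, 's) sqcomplex \<Rightarrow> ('v, 'e, 's) cell set \<Rightarrow> bool" where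
  "standard_product_subcomplex Y K \<longleftrightarrow>
    (\<exists>(G :: ('v, 'e) cgraph) (H :: ('v, 'e) cgraph) \<iota>.
      standard_product_structure G H Y \<iota> \<and> K = on_cells \<iota> ` cells (product_complex G H))"

text \<open>Injectivity is demanded of all standard product structures with image \<open>K\<close>.\<close>

definition embedded_product_subcomplex ::
  "('v, 'e, 's) sqcomplex \<Rightarrow> ('v, 'e, 's) cell set \<Rightarrow> bool" where
  "embedded_product_subcomplex Y K \<longleftrightarrow> standard_product_subcomplex Y K \<and>
    (\<forall>(G :: ('v, 'e) cgraph) (H :: ('v, 'e) cgraph) \<iota>.
      standard_product_structure G H Y \<iota> \<and> K = on_cells \<iota> ` cells (product_complex G H) \<longrightarrow>
      inj_on (on_cells \<iota>) (cells (product_complex G H)))"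

definition maximal_product_subcomplex ::
  "('v, 'e, 's) sqcomplex \<Rightarrow> ('v, 'e, 's) cell set \<Rightarrow> bool" where
  "maximal_product_subcomplex Y K \<longleftrightarrow> standard_product_subcomplex Y K \<and>
    (\<forall>K'. standard_product_subcomplex Y K' \<and> K \<subseteq> K' \<longrightarrow> K' = K)"

section \<open>The unordered discrete two-point configuration space of a simple graph\<close>

text \<open>
  Simple graphs are represented as in \<^theory>\<open>Graph_Theory.Pair_Digraph\<close>: an edge with endpoints
  \<open>u\<close>, \<open>v\<close> is the pair of arcs \<open>(u, v)\<close>, \<open>(v, u)\<close>.

  The arc \<open>(w, (u, v))\<close> of the configuration space is the edge \<open>{w, uv}\<close>, oriented from
  \<open>{w, u}\<close> to \<open>{w, v}\<close>.  The square \<open>(a, b)\<close>, for disjoint arcs \<open>a\<close> and \<open>b\<close>, is \<open>(x,y) \<mapsto> {a x, b y}\<close>;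
  so the eight parametrisations of the \<open>2\<close>-cell given by an unordered pair of disjoint edges are the
  orderings of the two edges together with an orientation of each.
\<close>

definition graph_cgraph :: "'a pair_pre_digraph \<Rightarrow> ('a, 'a \<times> 'a) cgraph" where
  "graph_cgraph \<Gamma> = \<lparr> dg = with_proj \<Gamma>, erev = swap_in (parcs \<Gamma>) \<rparr>"

definition UD2_skeleton :: "'a pair_pre_digraph \<Rightarrow> ('a uprod, 'a \<times> 'a \<times> 'a) pre_digraph" where
  "UD2_skeleton \<Gamma> = \<lparr>
     verts = {Upair u v | u v. u \<in> pverts \<Gamma> \<and> v \<in> pverts \<Gamma> \<and> u \<noteq> v},
     arcs = {(w, (u, v)) | w u v. w \<in> pverts \<Gamma> \<and> (u, v) \<in> parcs \<Gamma> \<and> w \<notin> {u, v}},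
     tail = (\<lambda>(w, (u, v)). Upair w u),
     head = (\<lambda>(w, (u, v)). Upair w v) \<rparr>"

definition UD2 ::
  "'a pair_pre_digraph \<Rightarrow> ('a uprod, 'a \<times> 'a \<times> 'a, ('a \<times> 'a) \<times> ('a \<times> 'a)) sqcomplex" where
  "UD2 \<Gamma> = \<lparr>
     dg = UD2_skeleton \<Gamma>,
     erev = perm_restrict (map_prod id prod.swap) (arcs (UD2_skeleton \<Gamma>)),
     squares = {(a, b) | a b. a \<in> parcs \<Gamma> \<and> b \<in> parcs \<Gamma> \<and> {fst a, snd a} \<inter> {fst b, snd b} = {}},
     bottom = (\<lambda>(a, b). (fst b, a)),
     sflip = map_prod prod.swap id,
     stransp = prod.swap \<rparr>"

definition conn_subgraph :: "'a pair_pre_digraph \<Rightarrow> 'a pair_pre_digraph \<Rightarrow> bool" where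
  "conn_subgraph \<Gamma>' \<Gamma> \<longleftrightarrow>
    subgraph (with_proj \<Gamma>') (with_proj \<Gamma>) \<and> cube_graph (graph_cgraph \<Gamma>')"

definition disjoint_leafless_pair ::
  "'a pair_pre_digraph \<Rightarrow> 'a pair_pre_digraph \<Rightarrow> 'a pair_pre_digraph \<Rightarrow> bool" where
  "disjoint_leafless_pair \<Gamma> \<Gamma>1 \<Gamma>2 \<longleftrightarrow>
    conn_subgraph \<Gamma>1 \<Gamma> \<and> conn_subgraph \<Gamma>2 \<Gamma> \<and> pverts \<Gamma>1 \<inter> pverts \<Gamma>2 = {} \<and>
    leafless (graph_cgraph \<Gamma>1) \<and> leafless (graph_cgraph \<Gamma>2)"

text \<open>The canonical map \<open>(x, y) \<mapsto> {x, y}\<close>, and its image \<open>\<Gamma>1 \<times>\<degree> \<Gamma>2\<close>.\<close>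

definition canonical_map ::
  "('a \<times> 'a, ('a \<times> 'a) \<times> 'a + 'a \<times> ('a \<times> 'a),
    ('a \<times> 'a) \<times> ('a \<times> 'a) + ('a \<times> 'a) \<times> ('a \<times> 'a),
    'a uprod, 'a \<times> 'a \<times> 'a, ('a \<times> 'a) \<times> ('a \<times> 'a)) sqmap" where
  "canonical_map = \<lparr>
     on_verts = (\<lambda>(x, y). Upair x y),
     on_edges = case_sum (\<lambda>(a, y). (y, a)) (\<lambda>(x, b). (x, b)),
     on_squares = case_sum (\<lambda>(a, b). (a, b)) (\<lambda>(b, a). (b, a)) \<rparr>"

definition ring_product ::
  "'a pair_pre_digraph \<Rightarrow> 'a pair_pre_digraph \<Rightarrow>
   ('a uprod, 'a \<times> 'a \<times> 'a, ('a \<times> 'a) \<times> ('a \<times> 'a)) cell set" where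
  "ring_product \<Gamma>1 \<Gamma>2 =
     on_cells canonical_map ` cells (product_complex (graph_cgraph \<Gamma>1) (graph_cgraph \<Gamma>2))"

section \<open>Non-positive curvature, and independence of the types of the factors\<close>

lemma product_complex_simps [simp]:
  "verts (dg (product_complex G H)) = verts (dg G) \<times> verts (dg H)"
  "arcs (dg (product_complex G H)) =
     (arcs (dg G) \<times> verts (dg H)) <+> (verts (dg G) \<times> arcs (dg H))"
  "tail (dg (product_complex G H)) (Inl (e, w)) = (tail (dg G) e, w)"
  "tail (dg (product_complex G H)) (Inr (v, d)) = (v, tail (dg H) d)"
  "head (dg (product_complex G H)) (Inl (e, w)) = (head (dg G) e, w)"
  "head (dg (product_complex G H)) (Inr (v, d)) = (v, head (dg H) d)"
  "squares (product_complex G H) =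
     (arcs (dg G) \<times> arcs (dg H)) <+> (arcs (dg H) \<times> arcs (dg G))"
  "bottom (product_complex G H) (Inl (e, d)) = Inl (e, tail (dg H) d)"
  "bottom (product_complex G H) (Inr (d, e)) = Inr (tail (dg G) e, d)"
  "sflip (product_complex G H) (Inl (e, d)) = Inl (erev G e, d)"
  "sflip (product_complex G H) (Inr (d, e)) = Inr (erev H d, e)"
  "stransp (product_complex G H) (Inl (e, d)) = Inr (d, e)"
  "stransp (product_complex G H) (Inr (d, e)) = Inl (e, d)"
  by (simp_all add: product_complex_def product_skeleton_def)

lemma erev_product_complex:
  "e \<in> arcs (dg G) \<Longrightarrow> w \<in> verts (dg H) \<Longrightarrow>
     erev (product_complex G H) (Inl (e, w)) = Inl (erev G e, w)"
  "v \<in> verts (dg G) \<Longrightarrow> d \<in> arcs (dg H) \<Longrightarrow>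
     erev (product_complex G H) (Inr (v, d)) = Inr (v, erev H d)"
  "x \<notin> arcs (dg (product_complex G H)) \<Longrightarrow> erev (product_complex G H) x = x"
  by (auto simp: product_complex_def product_skeleton_def perm_restrict_def)

lemma npc_square_complexI:
  assumes "square_complex X"
    and "\<And>s. s \<in> squares X \<Longrightarrow> bottom X s \<noteq> left_side X s"
    and "\<And>s t. s \<in> squares X \<Longrightarrow> t \<in> squares X \<Longrightarrow>
      bottom X s = bottom X t \<Longrightarrow> left_side X s = left_side X t \<Longrightarrow> s = t"
    and "\<And>s t r. s \<in> squares X \<Longrightarrow> t \<in> squares X \<Longrightarrow> r \<in> squares X \<Longrightarrow>
      left_side X s = bottom X t \<Longrightarrow> left_side X t = bottom X r \<Longrightarrow>
      left_side X r = bottom X s \<Longrightarrow> False"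
  shows "npc_square_complex X"
  unfolding npc_square_complex_def corners_def
  apply (intro conjI ballI impI notI)
  subgoal by (rule assms(1))
  subgoal using assms(2) by blast
  subgoal using assms(3) by blast
  subgoal using assms(4) by blast
  done

lemma npc_product_complex:
  assumes "cube_graph G" "cube_graph H"
  shows "npc_square_complex (product_complex G H)"
proof -
  interpret G: bidirected_digraph "dg G" "erev G" using assms by (simp add: cube_graph_def)
  interpret H: bidirected_digraph "dg H" "erev H" using assms by (simp add: cube_graph_def)
  let ?X = "product_complex G H"
  have wf: "wf_digraph (dg ?X)"
    by unfold_locales auto
  have bi: "bidirected_digraph (dg ?X) (erev ?X)"
  proof (rule wf_digraph.bidirected_digraphI[OF wf])
    show "erev ?X a = a" if "a \<notin> arcs (dg ?X)" for a
      by (rule erev_product_complex(3)[OF that])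
  qed (auto simp: erev_product_complex G.arev_neq H.arev_neq)
  have "square_complex ?X"
  proof (rule square_complex.intro)
    show "bidirected_digraph (dg ?X) (erev ?X)" by (rule bi)
  qed (auto simp: left_side_def erev_product_complex G.arev_neq H.arev_neq)
  then show ?thesis
    by (rule npc_square_complexI) (auto simp: left_side_def)
qed

lemma UD2_simps [simp]:
  "verts (dg (UD2 \<Gamma>)) = {Upair u v | u v. u \<in> pverts \<Gamma> \<and> v \<in> pverts \<Gamma> \<and> u \<noteq> v}"
  "(w, (u, v)) \<in> arcs (dg (UD2 \<Gamma>)) \<longleftrightarrow>
     w \<in> pverts \<Gamma> \<and> (u, v) \<in> parcs \<Gamma> \<and> w \<noteq> u \<and> w \<noteq> v"
  "tail (dg (UD2 \<Gamma>)) (w, (u, v)) = Upair w u"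
  "head (dg (UD2 \<Gamma>)) (w, (u, v)) = Upair w v"
  "((u, v), (x, y)) \<in> squares (UD2 \<Gamma>) \<longleftrightarrow>
     (u, v) \<in> parcs \<Gamma> \<and> (x, y) \<in> parcs \<Gamma> \<and> u \<noteq> x \<and> u \<noteq> y \<and> v \<noteq> x \<and> v \<noteq> y"
  "bottom (UD2 \<Gamma>) (a, (x, y)) = (x, a)"
  "sflip (UD2 \<Gamma>) ((u, v), b) = ((v, u), b)"
  "stransp (UD2 \<Gamma>) (a, b) = (b, a)"
  by (auto simp: UD2_def UD2_skeleton_def)

lemma square_cases:
  obtains u v x y where "s = ((u, v), (x, y))"
  by (cases s) auto

lemma erev_UD2:
  "(w, (u, v)) \<in> arcs (dg (UD2 \<Gamma>)) \<Longrightarrow> erev (UD2 \<Gamma>) (w, (u, v)) = (w, (v, u))"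
  "x \<notin> arcs (dg (UD2 \<Gamma>)) \<Longrightarrow> erev (UD2 \<Gamma>) x = x"
  by (auto simp: UD2_def perm_restrict_def)

lemma npc_UD2:
  assumes "pair_graph \<Gamma>"
  shows "npc_square_complex (UD2 \<Gamma>)"
proof -
  interpret pair_graph \<Gamma> by fact
  let ?X = "UD2 \<Gamma>"
  have sym: "(v, u) \<in> parcs \<Gamma>" if "(u, v) \<in> parcs \<Gamma>" for u v
    using that arcs_symmetric by blast
  have irr: "u \<noteq> v" if "(u, v) \<in> parcs \<Gamma>" for u v
    using that no_loops' by blast
  have inv: "u \<in> pverts \<Gamma>" "v \<in> pverts \<Gamma>" if "(u, v) \<in> parcs \<Gamma>" for u v
    using that by (auto dest: in_arcsD1 in_arcsD2)
  have wf: "wf_digraph (dg ?X)"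
  proof
    fix e assume e: "e \<in> arcs (dg ?X)"
    obtain w u v where "e = (w, (u, v))" by (metis surj_pair)
    then show "tail (dg ?X) e \<in> verts (dg ?X)" "head (dg ?X) e \<in> verts (dg ?X)"
      using e inv[of u v] by auto
  qed
  have bi: "bidirected_digraph (dg ?X) (erev ?X)"
  proof (rule wf_digraph.bidirected_digraphI[OF wf])
    fix e
    show "erev ?X e = e" if "e \<notin> arcs (dg ?X)"
      by (rule erev_UD2(2)[OF that])
    assume e: "e \<in> arcs (dg ?X)"
    obtain w u v where uv: "e = (w, (u, v))" by (metis surj_pair)
    then have r: "erev ?X e = (w, (v, u))" "(w, (v, u)) \<in> arcs (dg ?X)" "u \<noteq> v"
      using e erev_UD2(1)[of w u v \<Gamma>] sym[of u v] irr[of u v] by auto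
    then show "erev ?X e \<noteq> e" "erev ?X (erev ?X e) = e" "tail (dg ?X) (erev ?X e) = head (dg ?X) e"
      using uv erev_UD2(1)[of w v u \<Gamma>] by auto
  qed
  have "square_complex ?X"
  proof (rule square_complex.intro)
    show "bidirected_digraph (dg ?X) (erev ?X)" by (rule bi)
    fix s assume s: "s \<in> squares ?X"
    obtain u v x y where uv: "s = ((u, v), (x, y))" by (metis surj_pair)
    note p = s[unfolded uv UD2_simps]
    have e: "(x, (u, v)) \<in> arcs (dg ?X)" using p inv by auto
    show "bottom ?X s \<in> arcs (dg ?X)" "sflip ?X s \<in> squares ?X" "stransp ?X s \<in> squares ?X"
      "sflip ?X (sflip ?X s) = s" "stransp ?X (stransp ?X s) = s" "stransp ?X s \<noteq> s"
      "sflip ?X (stransp ?X (sflip ?X (stransp ?X s))) = stransp ?X (sflip ?X (stransp ?X (sflip ?X s)))"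
      "sflip ?X (stransp ?X (sflip ?X (stransp ?X s))) \<noteq> s"
      "bottom ?X (sflip ?X s) = erev ?X (bottom ?X s)"
      "tail (dg ?X) (left_side ?X s) = tail (dg ?X) (bottom ?X s)"
      using p inv sym irr[of u v] erev_UD2(1)[OF e] by (auto simp: uv left_side_def)
  qed
  then show ?thesis
  proof (rule npc_square_complexI)
    fix s assume s: "s \<in> squares ?X"
    obtain u v x y where uv: "s = ((u, v), (x, y))" by (rule square_cases)
    show "bottom ?X s \<noteq> left_side ?X s"
      using s by (simp add: uv left_side_def)
    fix t assume t: "t \<in> squares ?X"
    obtain u' v' x' y' where uv': "t = ((u', v'), (x', y'))" by (rule square_cases)
    show "s = t" if "bottom ?X s = bottom ?X t" "left_side ?X s = left_side ?X t"
      using that by (simp add: uv uv' left_side_def)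
    fix r assume r: "r \<in> squares ?X"
    obtain u'' v'' x'' y'' where uv'': "r = ((u'', v''), (x'', y''))" by (rule square_cases)
    show False if "left_side ?X s = bottom ?X t" "left_side ?X t = bottom ?X r"
      "left_side ?X r = bottom ?X s"
    proof -
      have "u = x'" using that(1) by (simp add: uv uv' left_side_def)
      moreover have "x' = u''" using that(2) by (simp add: uv' uv'' left_side_def)
      moreover have "u'' = x" using that(3) by (simp add: uv uv'' left_side_def)
      ultimately show False using s by (simp add: uv)
    qed
  qed
qed

text \<open>Replacing the factors of a product structure by isomorphic copies.\<close>

definition cgraph_iso ::
  "('v, 'e) cgraph \<Rightarrow> ('w, 'd) cgraph \<Rightarrow> ('v \<Rightarrow> 'w) \<Rightarrow> ('e \<Rightarrow> 'd) \<Rightarrow> bool" where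
  "cgraph_iso G H a b \<longleftrightarrow>
    bij_betw a (verts (dg G)) (verts (dg H)) \<and> bij_betw b (arcs (dg G)) (arcs (dg H)) \<and>
    (\<forall>e \<in> arcs (dg G). tail (dg H) (b e) = a (tail (dg G) e) \<and> b (erev G e) = erev H (b e))"

lemma cgraph_copy:
  fixes G :: "('v, 'e) cgraph" and a :: "'v \<Rightarrow> 'w" and b :: "'e \<Rightarrow> 'd"
  assumes G: "cube_graph G" "leafless G"
    and inj: "inj_on a (verts (dg G))" "inj_on b (arcs (dg G))"
  obtains G' :: "('w, 'd) cgraph" and a' b'
    where "cube_graph G'" "leafless G'" "cgraph_iso G' G a' b'"
proof -
  interpret G: bidirected_digraph "dg G" "erev G" using G by (simp add: cube_graph_def)
  define b' where "b' = the_inv_into (arcs (dg G)) b"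
  define a' where "a' = the_inv_into (verts (dg G)) a"
  define hom where "hom = \<lparr>iso_verts = a, iso_arcs = b,
    iso_head = (\<lambda>e. a (head (dg G) (b' e))), iso_tail = (\<lambda>e. a (tail (dg G) (b' e)))\<rparr>"
  define G' where "G' = \<lparr>dg = app_iso hom (dg G),
    erev = perm_restrict (b \<circ> erev G \<circ> b') (b ` arcs (dg G))\<rparr>"
  have b'b [simp]: "b' (b e) = e" if "e \<in> arcs (dg G)" for e
    using inj that by (simp add: b'_def the_inv_into_f_f)
  have a'a [simp]: "a' (a v) = v" if "v \<in> verts (dg G)" for v
    using inj that by (simp add: a'_def the_inv_into_f_f)
  have hom: "G.digraph_isomorphism hom"
    using inj G.wf_digraph by (simp add: G.digraph_isomorphism_def hom_def)
  have d: "dg G' = app_iso hom (dg G)" "verts (dg G') = a ` verts (dg G)"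
    "arcs (dg G') = b ` arcs (dg G)"
    "tail (dg G') = (\<lambda>e. a (tail (dg G) (b' e)))" "head (dg G') = (\<lambda>e. a (head (dg G) (b' e)))"
    by (simp_all add: G'_def hom_def)
  have r: "erev G' (b e) = b (erev G e)" if "e \<in> arcs (dg G)" for e
    using that by (simp add: G'_def perm_restrict_def)
  have wf: "wf_digraph (dg G')"
    unfolding d(1) by (rule G.wf_digraphI_app_iso[OF hom])
  have "bidirected_digraph (dg G') (erev G')"
  proof (rule wf_digraph.bidirected_digraphI[OF wf])
    fix e
    show "erev G' e = e" if "e \<notin> arcs (dg G')"
      using that unfolding d(3) by (simp add: G'_def perm_restrict_def)
    assume "e \<in> arcs (dg G')"
    then obtain x where x: "e = b x" "x \<in> arcs (dg G)" unfolding d(3) by blast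
    show "erev G' e \<noteq> e" "erev G' (erev G' e) = e"
      using x by (auto simp: r dest: inj_onD[OF inj(2)] G.arev_neq)
    show "tail (dg G') (erev G' e) = head (dg G') e"
      using x by (simp add: r d(4,5))
  qed
  moreover have "connected (dg G')"
    unfolding d(1) using G(1) G.connectedI_app_iso[OF _ hom] by (simp add: cube_graph_def)
  moreover have "arcs (dg G') \<noteq> {}"
    using G(1) by (simp add: d(3) cube_graph_def)
  ultimately have "cube_graph G'" by (simp add: cube_graph_def)
  moreover have "out_degree (dg G') (a v) = out_degree (dg G) v" if "v \<in> verts (dg G)" for v
    unfolding d(1) using G.out_degree_app_iso_eq[OF hom that] by (simp add: hom_def)
  then have "leafless G'"
    using G(2) by (simp add: leafless_def d(2))
  moreover have "cgraph_iso G' G a' b'"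
  proof -
    have "bij_betw a' (verts (dg G')) (verts (dg G))"
      unfolding a'_def d(2) using inj(1) by (simp add: bij_betw_the_inv_into inj_on_imp_bij_betw)
    moreover have "bij_betw b' (arcs (dg G')) (arcs (dg G))"
      unfolding b'_def d(3) using inj(2) by (simp add: bij_betw_the_inv_into inj_on_imp_bij_betw)
    moreover have "tail (dg G) (b' e) = a' (tail (dg G') e) \<and> b' (erev G' e) = erev G (b' e)"
      if "e \<in> arcs (dg G')" for e
      using that unfolding d(3) by (auto simp: d(4) r)
    ultimately show ?thesis by (simp add: cgraph_iso_def)
  qed
  ultimately show thesis by (rule that)
qed

definition sqmap_comp ::
  "('v1, 'e1, 's1, 'v2, 'e2, 's2) sqmap \<Rightarrow> ('v, 'e, 's, 'v1, 'e1, 's1) sqmap \<Rightarrow>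
   ('v, 'e, 's, 'v2, 'e2, 's2) sqmap" where
  "sqmap_comp \<phi> \<psi> = \<lparr>on_verts = on_verts \<phi> \<circ> on_verts \<psi>, on_edges = on_edges \<phi> \<circ> on_edges \<psi>,
     on_squares = on_squares \<phi> \<circ> on_squares \<psi>\<rparr>"

lemma on_cells_comp: "on_cells (sqmap_comp \<phi> \<psi>) = on_cells \<phi> \<circ> on_cells \<psi>"
  by (simp add: on_cells_def sqmap_comp_def cell.map_comp fun_eq_iff)

lemma on_cells_simps [simp]:
  "on_cells \<phi> (Vertex v) = Vertex (on_verts \<phi> v)"
  "on_cells \<phi> (Edge e) = Edge (on_edges \<phi> e)"
  "on_cells \<phi> (Square s) = Square (on_squares \<phi> s)"
  by (simp_all add: on_cells_def)

definition sqcomplex_iso ::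
  "('v, 'e, 's) sqcomplex \<Rightarrow> ('v1, 'e1, 's1) sqcomplex \<Rightarrow> ('v, 'e, 's, 'v1, 'e1, 's1) sqmap \<Rightarrow> bool"
  where
  "sqcomplex_iso X X1 \<psi> \<longleftrightarrow> combinatorial_map X X1 \<psi> \<and>
    bij_betw (on_verts \<psi>) (verts (dg X)) (verts (dg X1)) \<and>
    bij_betw (on_edges \<psi>) (arcs (dg X)) (arcs (dg X1)) \<and>
    bij_betw (on_squares \<psi>) (squares X) (squares X1)"

lemma sqcomplex_iso_cells:
  assumes "sqcomplex_iso X X1 \<psi>"
  shows "bij_betw (on_cells \<psi>) (cells X) (cells X1)"
proof -
  have "inj_on (on_cells \<psi>) (cells X)"
    using assms
    by (auto intro!: inj_onI simp: cells_def sqcomplex_iso_def bij_betw_def dest: inj_onD)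
  moreover have "on_cells \<psi> ` cells X = cells X1"
    using assms
    unfolding cells_def image_Un image_image on_cells_simps
    by (simp add: sqcomplex_iso_def bij_betw_def flip: image_image)
  ultimately show ?thesis by (simp add: bij_betw_def)
qed

lemma local_isometry_comp_iso:
  assumes "local_isometry X1 Y \<phi>" "sqcomplex_iso X X1 \<psi>" "npc_square_complex X"
  shows "local_isometry X Y (sqmap_comp \<phi> \<psi>)"
proof -
  interpret square_complex X using assms(3) by (simp add: npc_square_complex_def)
  have \<psi>: "combinatorial_map X X1 \<psi>"
    and bv: "bij_betw (on_verts \<psi>) (verts (dg X)) (verts (dg X1))"
    and be: "bij_betw (on_edges \<psi>) (arcs (dg X)) (arcs (dg X1))"
    and bs: "bij_betw (on_squares \<psi>) (squares X) (squares X1)"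
    using assms(2) by (auto simp: sqcomplex_iso_def)
  interpret bidirected_digraph "dg X" "erev X" by (rule skeleton)
  have \<phi>: "combinatorial_map X1 Y \<phi>"
    using assms(1) by (simp add: local_isometry_def)
  have comp: "combinatorial_map X Y (sqmap_comp \<phi> \<psi>)"
    using \<psi> \<phi> by (auto simp: combinatorial_map_def sqmap_comp_def)
  have out: "on_edges \<psi> ` out_arcs (dg X) v = out_arcs (dg X1) (on_verts \<psi> v)"
    and corn: "on_squares \<psi> ` corners X v = corners X1 (on_verts \<psi> v)"
    if v: "v \<in> verts (dg X)" for v
  proof -
    have ve: "on_verts \<psi> (tail (dg X) e) = on_verts \<psi> v \<longleftrightarrow> tail (dg X) e = v"
      if "e \<in> arcs (dg X)" for e
      using bv v that by (metis bij_betw_def inj_onD tail_in_verts)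
    have "out_arcs (dg X1) (on_verts \<psi> v)
        = {e \<in> on_edges \<psi> ` arcs (dg X). tail (dg X1) e = on_verts \<psi> v}"
      using be by (simp add: out_arcs_def bij_betw_def)
    also have "\<dots> = on_edges \<psi> ` {e \<in> arcs (dg X). tail (dg X) e = v}"
      using \<psi> ve by (auto simp: combinatorial_map_def)
    finally show "on_edges \<psi> ` out_arcs (dg X) v = out_arcs (dg X1) (on_verts \<psi> v)"
      by (simp add: out_arcs_def)
    have "corners X1 (on_verts \<psi> v)
        = {s \<in> on_squares \<psi> ` squares X. tail (dg X1) (bottom X1 s) = on_verts \<psi> v}"
      using bs by (simp add: corners_def bij_betw_def)
    also have "\<dots> = on_squares \<psi> ` {s \<in> squares X. tail (dg X) (bottom X s) = v}"
      using \<psi> ve bottom_in by (auto simp: combinatorial_map_def)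
    finally show "on_squares \<psi> ` corners X v = corners X1 (on_verts \<psi> v)"
      by (simp add: corners_def)
  qed
  have sub: "out_arcs (dg X) v \<subseteq> arcs (dg X)" "corners X v \<subseteq> squares X" for v
    by (auto simp: corners_def)
  have "inj_on (on_edges (sqmap_comp \<phi> \<psi>)) (out_arcs (dg X) v) \<and>
      inj_on (on_squares (sqmap_comp \<phi> \<psi>)) (corners X v) \<and>
      (\<forall>t \<in> corners Y (on_verts (sqmap_comp \<phi> \<psi>) v).
        bottom Y t \<in> on_edges (sqmap_comp \<phi> \<psi>) ` out_arcs (dg X) v \<and>
        left_side Y t \<in> on_edges (sqmap_comp \<phi> \<psi>) ` out_arcs (dg X) v \<longrightarrow>
        t \<in> on_squares (sqmap_comp \<phi> \<psi>) ` corners X v)"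
    if v: "v \<in> verts (dg X)" for v
  proof -
    have v1: "on_verts \<psi> v \<in> verts (dg X1)" using bv v by (auto simp: bij_betw_def)
    have "inj_on (on_edges \<psi>) (out_arcs (dg X) v)" "inj_on (on_squares \<psi>) (corners X v)"
      using inj_on_subset[OF bij_betw_imp_inj_on[OF be] sub(1)]
        inj_on_subset[OF bij_betw_imp_inj_on[OF bs] sub(2)] by blast+
    moreover have
      "inj_on (on_edges \<phi>) (out_arcs (dg X1) (on_verts \<psi> v))"
      "inj_on (on_squares \<phi>) (corners X1 (on_verts \<psi> v))"
      "\<forall>t \<in> corners Y (on_verts \<phi> (on_verts \<psi> v)).
        bottom Y t \<in> on_edges \<phi> ` out_arcs (dg X1) (on_verts \<psi> v) \<and>
        left_side Y t \<in> on_edges \<phi> ` out_arcs (dg X1) (on_verts \<psi> v) \<longrightarrow>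
        t \<in> on_squares \<phi> ` corners X1 (on_verts \<psi> v)"
      using assms(1) v1 by (auto simp: local_isometry_def)
    moreover have
      "on_edges (sqmap_comp \<phi> \<psi>) ` out_arcs (dg X) v = on_edges \<phi> ` out_arcs (dg X1) (on_verts \<psi> v)"
      "on_squares (sqmap_comp \<phi> \<psi>) ` corners X v = on_squares \<phi> ` corners X1 (on_verts \<psi> v)"
      by (simp_all add: sqmap_comp_def image_comp flip: out[OF v] corn[OF v])
    moreover have "inj_on (on_edges (sqmap_comp \<phi> \<psi>)) (out_arcs (dg X) v)"
      "inj_on (on_squares (sqmap_comp \<phi> \<psi>)) (corners X v)"
      unfolding sqmap_comp_def sqmap.simps
      by (rule comp_inj_on; simp add: calculation out[OF v] corn[OF v])+
    moreover have "on_verts (sqmap_comp \<phi> \<psi>) v = on_verts \<phi> (on_verts \<psi> v)"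
      by (simp add: sqmap_comp_def)
    ultimately show ?thesis by metis
  qed
  then show ?thesis
    using assms(1,3) comp by (simp add: local_isometry_def)
qed

definition product_map ::
  "('v1 \<Rightarrow> 'v) \<Rightarrow> ('e1 \<Rightarrow> 'e) \<Rightarrow> ('w1 \<Rightarrow> 'w) \<Rightarrow> ('d1 \<Rightarrow> 'd) \<Rightarrow>
   ('v1 \<times> 'w1, 'e1 \<times> 'w1 + 'v1 \<times> 'd1, 'e1 \<times> 'd1 + 'd1 \<times> 'e1,
    'v \<times> 'w, 'e \<times> 'w + 'v \<times> 'd, 'e \<times> 'd + 'd \<times> 'e) sqmap" where
  "product_map a b c d = \<lparr>
     on_verts = map_prod a c,
     on_edges = map_sum (map_prod b c) (map_prod a d),
     on_squares = map_sum (map_prod b d) (map_prod d b)\<rparr>"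

lemma bij_betw_map_sum:
  assumes "bij_betw f A C" "bij_betw g B D"
  shows "bij_betw (map_sum f g) (A <+> B) (C <+> D)"
proof -
  have "inj_on (map_sum f g) (A <+> B)"
    using assms by (auto intro!: inj_onI simp: bij_betw_def dest: inj_onD)
  moreover have "map_sum f g ` (A <+> B) = C <+> D"
    using assms unfolding bij_betw_def by (force simp: Plus_def image_Un image_image)
  ultimately show ?thesis by (simp add: bij_betw_def)
qed

lemma sqcomplex_iso_product_map:
  assumes "cube_graph G'" "cube_graph H'" and G: "cgraph_iso G' G a b" and H: "cgraph_iso H' H c d"
  shows "sqcomplex_iso (product_complex G' H') (product_complex G H) (product_map a b c d)"
proof -
  interpret G': bidirected_digraph "dg G'" "erev G'" using assms by (simp add: cube_graph_def)
  interpret H': bidirected_digraph "dg H'" "erev H'" using assms by (simp add: cube_graph_def)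
  have bij: "bij_betw a (verts (dg G')) (verts (dg G))" "bij_betw b (arcs (dg G')) (arcs (dg G))"
    "bij_betw c (verts (dg H')) (verts (dg H))" "bij_betw d (arcs (dg H')) (arcs (dg H))"
    using G H by (auto simp: cgraph_iso_def)
  then have im: "a v \<in> verts (dg G)" if "v \<in> verts (dg G')" for v
    using that by (auto simp: bij_betw_def)
  moreover have "b e \<in> arcs (dg G)" if "e \<in> arcs (dg G')" for e
    using that bij by (auto simp: bij_betw_def)
  moreover have "c w \<in> verts (dg H)" if "w \<in> verts (dg H')" for w
    using that bij by (auto simp: bij_betw_def)
  moreover have "d e \<in> arcs (dg H)" if "e \<in> arcs (dg H')" for e
    using that bij by (auto simp: bij_betw_def)
  ultimately have "combinatorial_map (product_complex G' H') (product_complex G H) (product_map a b c d)"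
    using G H unfolding cgraph_iso_def
    by (auto simp: combinatorial_map_def product_map_def erev_product_complex)
  then show ?thesis
    using bij by (simp add: sqcomplex_iso_def product_map_def bij_betw_map_sum bij_betw_map_prod)
qed

lemma standard_product_structure_retype:
  fixes G :: "('x, 'c) cgraph" and H :: "('y, 'd) cgraph" and Y :: "('v, 'e, 's) sqcomplex"
  assumes "standard_product_structure G H Y \<iota>"
  obtains G' H' :: "('v, 'e) cgraph" and \<iota>' where
    "standard_product_structure G' H' Y \<iota>'"
    "on_cells \<iota>' ` cells (product_complex G' H') = on_cells \<iota> ` cells (product_complex G H)"
    "inj_on (on_cells \<iota>') (cells (product_complex G' H')) \<longleftrightarrow>
     inj_on (on_cells \<iota>) (cells (product_complex G H))"
proof -
  have G: "cube_graph G" "leafless G" and H: "cube_graph H" "leafless H"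
    and li: "local_isometry (product_complex G H) Y \<iota>"
    using assms by (auto simp: standard_product_structure_def product_structure_def)
  obtain v w where vw: "v \<in> verts (dg G)" "w \<in> verts (dg H)"
    and i1: "inj_on (on_cells \<iota>) (first_slice G w)"
    and i2: "inj_on (on_cells \<iota>) (second_slice v H)"
    using assms by (auto simp: standard_product_structure_def product_structure_def)
  have "inj_on (\<lambda>v. on_verts \<iota> (v, w)) (verts (dg G))" "inj_on (\<lambda>e. on_edges \<iota> (Inl (e, w))) (arcs (dg G))"
    using inj_onD[OF i1, of "Vertex (x, w)" "Vertex (y, w)" for x y]
      inj_onD[OF i1, of "Edge (Inl (x, w))" "Edge (Inl (y, w))" for x y]
    unfolding inj_on_def by (simp_all add: first_slice_def image_iff)
  then obtain G' :: "('v, 'e) cgraph" and a b where G': "cube_graph G'" "leafless G'" "cgraph_iso G' G a b"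
    using cgraph_copy[OF G] by metis
  have "inj_on (\<lambda>w. on_verts \<iota> (v, w)) (verts (dg H))" "inj_on (\<lambda>e. on_edges \<iota> (Inr (v, e))) (arcs (dg H))"
    using inj_onD[OF i2, of "Vertex (v, x)" "Vertex (v, y)" for x y]
      inj_onD[OF i2, of "Edge (Inr (v, x))" "Edge (Inr (v, y))" for x y]
    unfolding inj_on_def by (simp_all add: second_slice_def image_iff)
  then obtain H' :: "('v, 'e) cgraph" and c d where H': "cube_graph H'" "leafless H'" "cgraph_iso H' H c d"
    using cgraph_copy[OF H] by metis
  define \<psi> where "\<psi> = product_map a b c d"
  have iso: "sqcomplex_iso (product_complex G' H') (product_complex G H) \<psi>"
    unfolding \<psi>_def by (rule sqcomplex_iso_product_map[OF G'(1) H'(1) G'(3) H'(3)])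
  note bij = sqcomplex_iso_cells[OF iso]
  have bG: "bij_betw a (verts (dg G')) (verts (dg G))" "bij_betw b (arcs (dg G')) (arcs (dg G))"
    and bH: "bij_betw c (verts (dg H')) (verts (dg H))" "bij_betw d (arcs (dg H')) (arcs (dg H))"
    using G'(3) H'(3) by (auto simp: cgraph_iso_def)
  obtain v' where v': "v' \<in> verts (dg G')" "a v' = v"
    using vw(1) bG(1) by (metis bij_betw_def imageE)
  obtain w' where w': "w' \<in> verts (dg H')" "c w' = w"
    using vw(2) bH(1) by (metis bij_betw_def imageE)
  have sl: "on_cells \<psi> ` first_slice G' w' \<subseteq> first_slice G w"
    "on_cells \<psi> ` second_slice v' H' \<subseteq> second_slice v H"
    using v' w' bG[THEN bij_betw_apply] bH[THEN bij_betw_apply]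
    by (auto simp: \<psi>_def product_map_def first_slice_def second_slice_def image_iff)
  have sub: "first_slice G' w' \<subseteq> cells (product_complex G' H')"
    "second_slice v' H' \<subseteq> cells (product_complex G' H')"
    using v' w' by (auto simp: first_slice_def second_slice_def cells_def)
  have inj: "inj_on (on_cells (sqmap_comp \<iota> \<psi>)) (first_slice G' w')"
    "inj_on (on_cells (sqmap_comp \<iota> \<psi>)) (second_slice v' H')"
    unfolding on_cells_comp
    using bij sub sl i1 i2
    by (auto intro!: comp_inj_on simp: bij_betw_def elim: inj_on_subset)
  have "local_isometry (product_complex G' H') Y (sqmap_comp \<iota> \<psi>)"
    by (rule local_isometry_comp_iso[OF li iso npc_product_complex[OF G'(1) H'(1)]])
  then have "standard_product_structure G' H' Y (sqmap_comp \<iota> \<psi>)"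
    using G' H' v' w' inj by (auto simp: standard_product_structure_def product_structure_def)
  moreover have "on_cells (sqmap_comp \<iota> \<psi>) ` cells (product_complex G' H')
      = on_cells \<iota> ` cells (product_complex G H)"
    using bij by (simp add: on_cells_comp bij_betw_def flip: image_image image_comp)
  moreover have "inj_on (on_cells (sqmap_comp \<iota> \<psi>)) (cells (product_complex G' H')) \<longleftrightarrow>
      inj_on (on_cells \<iota>) (cells (product_complex G H))"
    using bij unfolding on_cells_comp by (metis bij_betw_def comp_inj_on_iff)
  ultimately show thesis by (rule that)
qed

end

theory Submission
  imports Defs
begin

text \<open>
  Write a point of the configuration space as two tokens on \<open>\<Gamma>\<close>.  In a square of \<open>UD2 \<Gamma>\<close> each token
  moves along an edge of its own, so opposite sides of the square carry the same edge of \<open>\<Gamma>\<close>.  For a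
  map \<open>\<iota>\<close> from a product \<open>G \<times> H\<close> to \<open>UD2 \<Gamma>\<close>, an edge \<open>e\<close> of \<open>G\<close> spans a square with every edge of \<open>H\<close>;
  as \<open>H\<close> is connected, the edge of \<open>\<Gamma>\<close> traversed along \<open>e \<times> {y}\<close> is the same for all \<open>y\<close>.  The
  same holds with the factors exchanged.  Hence one token depends on the \<open>G\<close>-coordinate only and the
  other one on the \<open>H\<close>-coordinate only: \<open>\<iota>\<close> is the map \<open>(x, y) \<mapsto> {f x, g y}\<close> for graph maps \<open>f\<close>
  and \<open>g\<close> to \<open>\<Gamma>\<close> with disjoint images (\<open>combinatorial_map_UD2_splits\<close>).

  Injectivity of \<open>\<iota>\<close> on one slice in each direction makes \<open>f\<close> and \<open>g\<close> isomorphisms onto subgraphs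
  \<open>\<Gamma>1\<close>, \<open>\<Gamma>2\<close> of \<open>\<Gamma>\<close>, which therefore are connected and leafless.  So \<open>\<iota>\<close> is the isomorphism
  \<open>f \<times> g\<close> followed by the canonical map of \<open>\<Gamma>1 \<times> \<Gamma>2\<close>, and the latter is injective because the two
  subgraphs are disjoint (\<open>standard_product_structure_UD2\<close>).  Conversely, the canonical map of a
  disjoint pair is a local isometry: two edges issuing from \<open>{x, y}\<close> bound a corner only if they move
  different tokens, and then they are an edge of \<open>\<Gamma>1\<close> at \<open>x\<close> and an edge of \<open>\<Gamma>2\<close> at \<open>y\<close>.

  For maximality it suffices to translate inclusions of products into inclusions of factors.  A
  square of \<open>\<Gamma>1 \<times> \<Gamma>2\<close> lying in \<open>\<Gamma>1' \<times> \<Gamma>2'\<close> assigns its two edges to \<open>\<Gamma>1'\<close> and \<open>\<Gamma>2'\<close> in one of two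
  ways, and by disjointness a single square decides the assignment for all others
  (\<open>ring_product_subset_cases\<close>).
\<close>

section \<open>Connected graphs\<close>

lemma connected_invariant_const:
  assumes "connected D"
    and inv: "\<And>e. e \<in> arcs D \<Longrightarrow> h (tail D e) = h (head D e)"
    and "u \<in> verts D" "v \<in> verts D"
  shows "h u = h v"
proof -
  have "(u, v) \<in> rtrancl_on (verts D) ((arcs_ends D)\<^sup>s)"
    using assms by (simp add: connected_conv)
  then show ?thesis
    by induct (auto simp: symcl_def arcs_ends_conv inv)
qed

lemma cube_graph_vertex_has_arc:
  assumes "cube_graph G" "v \<in> verts (dg G)"
  shows "\<exists>e \<in> arcs (dg G). tail (dg G) e = v"
proof (rule ccontr)
  interpret bidirected_digraph "dg G" "erev G" using assms(1) by (simp add: cube_graph_def)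
  assume "\<not> ?thesis"
  then have no: "tail (dg G) e \<noteq> v" if "e \<in> arcs (dg G)" for e
    using that by blast
  moreover have "head (dg G) e \<noteq> v" if "e \<in> arcs (dg G)" for e
    using no[of "erev G e"] that by simp
  \<comment> \<open>If no arc meets \<open>v\<close>, then being equal to \<open>v\<close> is constant along arcs, hence constant on \<open>G\<close>.\<close>
  ultimately have inv: "(tail (dg G) e = v) = (head (dg G) e = v)" if "e \<in> arcs (dg G)" for e
    using no that by simp
  obtain e where e: "e \<in> arcs (dg G)" using assms(1) unfolding cube_graph_def by blast
  have "(v = v) = (tail (dg G) e = v)"
    using connected_invariant_const[of "dg G" "\<lambda>u. u = v", OF _ inv assms(2) tail_in_verts[OF e]] assms(1)
    unfolding cube_graph_def by blast
  then show False using no[OF e] by simp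
qed

lemma graph_cgraph_simps [simp]:
  "dg (graph_cgraph \<Gamma>) = with_proj \<Gamma>"
  "erev (graph_cgraph \<Gamma>) = swap_in (parcs \<Gamma>)"
  by (simp_all add: graph_cgraph_def)

lemma conn_subgraph_arcD:
  assumes "conn_subgraph \<Gamma>' \<Gamma>" "(u, v) \<in> parcs \<Gamma>'"
  shows "u \<in> pverts \<Gamma>'" "v \<in> pverts \<Gamma>'" "(v, u) \<in> parcs \<Gamma>'"
proof -
  interpret bidirected_digraph "with_proj \<Gamma>'" "swap_in (parcs \<Gamma>')"
    using assms(1) by (simp add: conn_subgraph_def cube_graph_def)
  have uv: "(u, v) \<in> arcs (with_proj \<Gamma>')" using assms(2) by simp
  show "u \<in> pverts \<Gamma>'" using tail_in_verts[OF uv] by simp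
  show "v \<in> pverts \<Gamma>'" using head_in_verts[OF uv] by simp
  show "(v, u) \<in> parcs \<Gamma>'" using arev_in_arcs[OF uv] assms(2) by (simp add: swap_in_def)
qed

lemma conn_subgraph_vertexE:
  assumes "conn_subgraph \<Gamma>' \<Gamma>" "u \<in> pverts \<Gamma>'"
  obtains v where "(u, v) \<in> parcs \<Gamma>'"
proof -
  have "cube_graph (graph_cgraph \<Gamma>')" "u \<in> verts (dg (graph_cgraph \<Gamma>'))"
    using assms by (simp_all add: conn_subgraph_def)
  from cube_graph_vertex_has_arc[OF this] obtain a where "a \<in> parcs \<Gamma>'" "fst a = u"
    unfolding graph_cgraph_simps with_proj_simps by blast
  then have "(u, snd a) \<in> parcs \<Gamma>'" by (cases a) simp
  then show thesis by (rule that)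
qed

lemma conn_subgraph_sub:
  assumes "conn_subgraph \<Gamma>' \<Gamma>"
  shows "pverts \<Gamma>' \<subseteq> pverts \<Gamma>" "parcs \<Gamma>' \<subseteq> parcs \<Gamma>"
  using assms unfolding conn_subgraph_def subgraph_def with_proj_simps by blast+

lemma conn_subgraph_arc_ex:
  assumes "conn_subgraph \<Gamma>' \<Gamma>"
  obtains u v where "(u, v) \<in> parcs \<Gamma>'"
proof -
  have "parcs \<Gamma>' \<noteq> {}" using assms by (simp add: conn_subgraph_def cube_graph_def)
  then obtain a where "a \<in> parcs \<Gamma>'" by blast
  then show thesis using that[of "fst a" "snd a"] by simp
qed

section \<open>The canonical map\<close>

lemma ring_product_iff:
  "Vertex p \<in> ring_product \<Gamma>1 \<Gamma>2 \<longleftrightarrow> (\<exists>x \<in> pverts \<Gamma>1. \<exists>y \<in> pverts \<Gamma>2. p = Upair x y)"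
  "Edge (w, a) \<in> ring_product \<Gamma>1 \<Gamma>2 \<longleftrightarrow>
     w \<in> pverts \<Gamma>2 \<and> a \<in> parcs \<Gamma>1 \<or> w \<in> pverts \<Gamma>1 \<and> a \<in> parcs \<Gamma>2"
  "Square (a, b) \<in> ring_product \<Gamma>1 \<Gamma>2 \<longleftrightarrow>
     a \<in> parcs \<Gamma>1 \<and> b \<in> parcs \<Gamma>2 \<or> a \<in> parcs \<Gamma>2 \<and> b \<in> parcs \<Gamma>1"
proof -
  have *: "ring_product \<Gamma>1 \<Gamma>2 =
      (\<lambda>p. Vertex (Upair (fst p) (snd p))) ` (pverts \<Gamma>1 \<times> pverts \<Gamma>2) \<union>
      (\<lambda>p. Edge (snd p, fst p)) ` (parcs \<Gamma>1 \<times> pverts \<Gamma>2) \<union> Edge ` (pverts \<Gamma>1 \<times> parcs \<Gamma>2) \<union>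
      Square ` (parcs \<Gamma>1 \<times> parcs \<Gamma>2) \<union> Square ` (parcs \<Gamma>2 \<times> parcs \<Gamma>1)"
    by (simp add: ring_product_def cells_def Plus_def image_Un image_image canonical_map_def
        case_prod_unfold Un_assoc)
  show "Vertex p \<in> ring_product \<Gamma>1 \<Gamma>2 \<longleftrightarrow> (\<exists>x \<in> pverts \<Gamma>1. \<exists>y \<in> pverts \<Gamma>2. p = Upair x y)"
    unfolding * by (simp add: image_iff bex_Un)
  show "Edge (w, a) \<in> ring_product \<Gamma>1 \<Gamma>2 \<longleftrightarrow>
      w \<in> pverts \<Gamma>2 \<and> a \<in> parcs \<Gamma>1 \<or> w \<in> pverts \<Gamma>1 \<and> a \<in> parcs \<Gamma>2"
    unfolding * by (simp add: image_iff bex_Un)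
  show "Square (a, b) \<in> ring_product \<Gamma>1 \<Gamma>2 \<longleftrightarrow>
      a \<in> parcs \<Gamma>1 \<and> b \<in> parcs \<Gamma>2 \<or> a \<in> parcs \<Gamma>2 \<and> b \<in> parcs \<Gamma>1"
    unfolding * by (simp add: image_iff bex_Un)
qed

lemma ring_product_commute:
  fixes \<Gamma>1 :: "'a pair_pre_digraph"
  shows "ring_product \<Gamma>1 \<Gamma>2 = ring_product \<Gamma>2 \<Gamma>1"
proof -
  have "c \<in> ring_product \<Gamma>1 \<Gamma>2 \<longleftrightarrow> c \<in> ring_product \<Gamma>2 \<Gamma>1" for c
  proof (cases c)
    case (Vertex p)
    have "Upair x y = Upair y x" for x y :: 'a by simp
    then show ?thesis unfolding Vertex ring_product_iff by metis
  next
    case (Edge e) then show ?thesis by (cases e) (simp add: ring_product_iff disj_commute)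
  next
    case (Square s) then show ?thesis by (cases s) (simp add: ring_product_iff disj_commute)
  qed
  then show ?thesis by blast
qed

lemma disjoint_leafless_pair_commute:
  "disjoint_leafless_pair \<Gamma> \<Gamma>1 \<Gamma>2 \<Longrightarrow> disjoint_leafless_pair \<Gamma> \<Gamma>2 \<Gamma>1"
  by (auto simp: disjoint_leafless_pair_def)

lemma ring_product_mono:
  assumes "pverts \<Gamma>1 \<subseteq> pverts \<Gamma>1'" "parcs \<Gamma>1 \<subseteq> parcs \<Gamma>1'"
    and "pverts \<Gamma>2 \<subseteq> pverts \<Gamma>2'" "parcs \<Gamma>2 \<subseteq> parcs \<Gamma>2'"
  shows "ring_product \<Gamma>1 \<Gamma>2 \<subseteq> ring_product \<Gamma>1' \<Gamma>2'"
proof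
  fix c assume "c \<in> ring_product \<Gamma>1 \<Gamma>2"
  then show "c \<in> ring_product \<Gamma>1' \<Gamma>2'"
  proof (cases c)
    case (Vertex p)
    then show ?thesis
      using \<open>c \<in> ring_product \<Gamma>1 \<Gamma>2\<close> assms(1,3) unfolding Vertex ring_product_iff by blast
  next
    case (Edge e) then show ?thesis
      using \<open>c \<in> ring_product \<Gamma>1 \<Gamma>2\<close> assms by (cases e) (auto simp: ring_product_iff)
  next
    case (Square s) then show ?thesis
      using \<open>c \<in> ring_product \<Gamma>1 \<Gamma>2\<close> assms by (cases s) (auto simp: ring_product_iff)
  qed
qed

text \<open>
  The alternative is inherent: the configurations are unordered, so exchanging the two factors does
  not change a product.  Only the edges have to be compared, because in a connected graph with an
  edge every vertex is an endpoint.
\<close>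

lemma ring_product_subset_cases:
  assumes P: "disjoint_leafless_pair \<Gamma> \<Gamma>1 \<Gamma>2" and P': "disjoint_leafless_pair \<Gamma> \<Gamma>1' \<Gamma>2'"
    and sub: "ring_product \<Gamma>1 \<Gamma>2 \<subseteq> ring_product \<Gamma>1' \<Gamma>2'"
  shows "subgraph (with_proj \<Gamma>1) (with_proj \<Gamma>1') \<and> subgraph (with_proj \<Gamma>2) (with_proj \<Gamma>2') \<or>
    subgraph (with_proj \<Gamma>1) (with_proj \<Gamma>2') \<and> subgraph (with_proj \<Gamma>2) (with_proj \<Gamma>1')"
proof -
  have c: "conn_subgraph \<Gamma>1 \<Gamma>" "conn_subgraph \<Gamma>2 \<Gamma>" "conn_subgraph \<Gamma>1' \<Gamma>" "conn_subgraph \<Gamma>2' \<Gamma>"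
    and disj: "pverts \<Gamma>1' \<inter> pverts \<Gamma>2' = {}"
    using P P' by (auto simp: disjoint_leafless_pair_def)
  have adisj: "parcs \<Gamma>1' \<inter> parcs \<Gamma>2' = {}"
    using conn_subgraph_arcD(1)[OF c(3)] conn_subgraph_arcD(1)[OF c(4)] disj by fast
  have sq: "a \<in> parcs \<Gamma>1' \<and> b \<in> parcs \<Gamma>2' \<or> a \<in> parcs \<Gamma>2' \<and> b \<in> parcs \<Gamma>1'"
    if "a \<in> parcs \<Gamma>1" "b \<in> parcs \<Gamma>2" for a b
    using sub that ring_product_iff(3)[of a b] by blast
  have *: "subgraph (with_proj \<Delta>) (with_proj \<Delta>')"
    if cc: "conn_subgraph \<Delta> \<Gamma>" "conn_subgraph \<Delta>' \<Gamma>" and s: "parcs \<Delta> \<subseteq> parcs \<Delta>'" for \<Delta> \<Delta>'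
  proof -
    have "pverts \<Delta> \<subseteq> pverts \<Delta>'"
      using conn_subgraph_vertexE[OF cc(1)] conn_subgraph_arcD(1)[OF cc(2)] s by blast
    then show ?thesis using cc s by (auto simp: conn_subgraph_def subgraph_def)
  qed
  obtain a where a: "a \<in> parcs \<Gamma>1" using conn_subgraph_arc_ex[OF c(1)] by metis
  obtain b where b: "b \<in> parcs \<Gamma>2" using conn_subgraph_arc_ex[OF c(2)] by metis
  \<comment> \<open>The square \<open>(a, b)\<close> fixes the side on which \<open>b\<close> lies, hence that of every other arc of \<open>\<Gamma>1\<close>;
    in the same way \<open>a\<close> fixes the side of the arcs of \<open>\<Gamma>2\<close>.\<close>
  have "parcs \<Gamma>1 \<subseteq> parcs \<Gamma>1' \<and> parcs \<Gamma>2 \<subseteq> parcs \<Gamma>2' \<or> parcs \<Gamma>1 \<subseteq> parcs \<Gamma>2' \<and> parcs \<Gamma>2 \<subseteq> parcs \<Gamma>1'"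
    using sq[OF a b] sq[OF _ b] sq[OF a] adisj by blast
  then show ?thesis using * c by blast
qed

text \<open>
  Strictly larger factors give a strictly larger product.  In the reverse inclusion the factors
  cannot be exchanged, since that would put \<open>\<Gamma>1'\<close> inside \<open>\<Gamma>2 \<subseteq> \<Gamma>2'\<close>.
\<close>

lemma ring_product_inject:
  assumes P: "disjoint_leafless_pair \<Gamma> \<Gamma>1 \<Gamma>2" and P': "disjoint_leafless_pair \<Gamma> \<Gamma>1' \<Gamma>2'"
    and s: "subgraph (with_proj \<Gamma>1) (with_proj \<Gamma>1')" "subgraph (with_proj \<Gamma>2) (with_proj \<Gamma>2')"
    and sub: "ring_product \<Gamma>1' \<Gamma>2' \<subseteq> ring_product \<Gamma>1 \<Gamma>2"
  shows "\<Gamma>1' = \<Gamma>1 \<and> \<Gamma>2' = \<Gamma>2"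
proof -
  have c: "conn_subgraph \<Gamma>1 \<Gamma>" "conn_subgraph \<Gamma>1' \<Gamma>" "conn_subgraph \<Gamma>2' \<Gamma>"
    and disj: "pverts \<Gamma>1' \<inter> pverts \<Gamma>2' = {}"
    using P P' by (auto simp: disjoint_leafless_pair_def)
  have "\<not> subgraph (with_proj \<Gamma>1') (with_proj \<Gamma>2)"
  proof
    assume "subgraph (with_proj \<Gamma>1') (with_proj \<Gamma>2)"
    moreover obtain u v where "(u, v) \<in> parcs \<Gamma>1'" using conn_subgraph_arc_ex[OF c(2)] .
    ultimately show False
      using s(2) disj conn_subgraph_arcD(1)[OF c(2), of u v]
      unfolding subgraph_def with_proj_simps by blast
  qed
  then have "subgraph (with_proj \<Gamma>1') (with_proj \<Gamma>1)" "subgraph (with_proj \<Gamma>2') (with_proj \<Gamma>2)"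
    using ring_product_subset_cases[OF P' P sub] by blast+
  then show ?thesis
    using s by (auto simp: subgraph_def intro!: pair_pre_digraph.equality)
qed

lemma inj_on_on_cellsI:
  assumes "inj_on (on_verts \<phi>) (verts (dg X))" "inj_on (on_edges \<phi>) (arcs (dg X))"
    and "inj_on (on_squares \<phi>) (squares X)"
  shows "inj_on (on_cells \<phi>) (cells X)"
  using assms by (auto intro!: inj_onI simp: cells_def dest: inj_onD)

text \<open>
  An unordered pair with one point in each of two disjoint graphs determines which point lies in
  which graph.
\<close>

lemma inj_on_canonical_map:
  assumes "disjoint_leafless_pair \<Gamma> \<Gamma>1 \<Gamma>2"
  defines "X \<equiv> product_complex (graph_cgraph \<Gamma>1) (graph_cgraph \<Gamma>2)"
  shows "inj_on (on_edges canonical_map) (arcs (dg X))"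
    and "inj_on (on_squares canonical_map) (squares X)"
    and "inj_on (on_cells canonical_map) (cells X)"
proof -
  have c: "conn_subgraph \<Gamma>1 \<Gamma>" "conn_subgraph \<Gamma>2 \<Gamma>" and disj: "pverts \<Gamma>1 \<inter> pverts \<Gamma>2 = {}"
    using assms by (auto simp: disjoint_leafless_pair_def)
  have adisj: "parcs \<Gamma>1 \<inter> parcs \<Gamma>2 = {}"
    using conn_subgraph_arcD(1)[OF c(1)] conn_subgraph_arcD(1)[OF c(2)] disj by fast
  have "inj_on (on_verts canonical_map) (verts (dg X))"
    using disj by (force intro!: inj_onI simp: X_def canonical_map_def)
  moreover show "inj_on (on_edges canonical_map) (arcs (dg X))"
    using disj by (force intro!: inj_onI simp: X_def canonical_map_def)
  moreover show "inj_on (on_squares canonical_map) (squares X)"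
    using adisj by (force intro!: inj_onI simp: X_def canonical_map_def)
  ultimately show "inj_on (on_cells canonical_map) (cells X)" by (rule inj_on_on_cellsI)
qed

text \<open>
  The condition on links is the fact that every edge of \<open>\<Gamma>1\<close> at \<open>x\<close> and every edge of \<open>\<Gamma>2\<close> at \<open>y\<close> span
  a square of the product, together with the observation that two edges of the same factor never
  bound a corner of \<open>UD2 \<Gamma>\<close>, since they move the same token.
\<close>

lemma local_isometry_canonical_map:
  assumes \<Gamma>: "pair_graph \<Gamma>" and P: "disjoint_leafless_pair \<Gamma> \<Gamma>1 \<Gamma>2"
  shows "local_isometry (product_complex (graph_cgraph \<Gamma>1) (graph_cgraph \<Gamma>2)) (UD2 \<Gamma>) canonical_map"
proof -
  let ?X = "product_complex (graph_cgraph \<Gamma>1) (graph_cgraph \<Gamma>2)"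
  have c: "conn_subgraph \<Gamma>1 \<Gamma>" "conn_subgraph \<Gamma>2 \<Gamma>" and disj: "pverts \<Gamma>1 \<inter> pverts \<Gamma>2 = {}"
    using P by (auto simp: disjoint_leafless_pair_def)
  then have cg: "cube_graph (graph_cgraph \<Gamma>1)" "cube_graph (graph_cgraph \<Gamma>2)"
    by (auto simp: conn_subgraph_def)
  have V: "x \<in> pverts \<Gamma>" "y \<in> pverts \<Gamma>" "x \<noteq> y" "y \<noteq> x" if "x \<in> pverts \<Gamma>1" "y \<in> pverts \<Gamma>2" for x y
    using that disj conn_subgraph_sub(1)[OF c(1)] conn_subgraph_sub(1)[OF c(2)] by blast+
  have E: "u \<in> pverts \<Delta> \<and> v \<in> pverts \<Delta> \<and> (v, u) \<in> parcs \<Delta> \<and> (u, v) \<in> parcs \<Gamma>"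
    if "conn_subgraph \<Delta> \<Gamma>" "(u, v) \<in> parcs \<Delta>" for \<Delta> u v
    using conn_subgraph_arcD[OF that] conn_subgraph_sub(2)[OF that(1)] that(2) by blast
  have comb: "combinatorial_map ?X (UD2 \<Gamma>) canonical_map"
    unfolding combinatorial_map_def
  proof (intro conjI ballI)
    fix e assume "e \<in> arcs (dg ?X)"
    then consider (1) a y where "e = Inl (a, y)" "a \<in> parcs \<Gamma>1" "y \<in> pverts \<Gamma>2"
      | (2) x a where "e = Inr (x, a)" "a \<in> parcs \<Gamma>2" "x \<in> pverts \<Gamma>1"
      by (force simp: graph_cgraph_def)
    then have "on_edges canonical_map e \<in> arcs (dg (UD2 \<Gamma>)) \<and>
      tail (dg (UD2 \<Gamma>)) (on_edges canonical_map e) = on_verts canonical_map (tail (dg ?X) e) \<and>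
      on_edges canonical_map (erev ?X e) = erev (UD2 \<Gamma>) (on_edges canonical_map e)"
    proof cases
      case 1
      obtain u v where a: "a = (u, v)" by fastforce
      have "u \<in> pverts \<Gamma>1" "v \<in> pverts \<Gamma>1" "(u, v) \<in> parcs \<Gamma>"
        using E[OF c(1), of u v] 1(2) a by blast+
      then have in_arcs: "(y, (u, v)) \<in> arcs (dg (UD2 \<Gamma>))"
        using V[OF _ 1(3)] by simp
      then show ?thesis
        using 1 a by (simp add: canonical_map_def erev_product_complex swap_in_def erev_UD2(1))
    next
      case 2
      obtain u v where a: "a = (u, v)" by fastforce
      have "u \<in> pverts \<Gamma>2" "v \<in> pverts \<Gamma>2" "(u, v) \<in> parcs \<Gamma>"
        using E[OF c(2), of u v] 2(2) a by blast+
      then have in_arcs: "(x, (u, v)) \<in> arcs (dg (UD2 \<Gamma>))"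
        using V[OF 2(3)] by simp
      then show ?thesis
        using 2 a by (simp add: canonical_map_def erev_product_complex swap_in_def erev_UD2(1))
    qed
    then show "on_edges canonical_map e \<in> arcs (dg (UD2 \<Gamma>))"
      "tail (dg (UD2 \<Gamma>)) (on_edges canonical_map e) = on_verts canonical_map (tail (dg ?X) e)"
      "on_edges canonical_map (erev ?X e) = erev (UD2 \<Gamma>) (on_edges canonical_map e)"
      by blast+
  next
    fix p assume "p \<in> verts (dg ?X)"
    then obtain x y where xy: "p = (x, y)" "x \<in> pverts \<Gamma>1" "y \<in> pverts \<Gamma>2" by auto
    have "on_verts canonical_map p = Upair x y" by (simp add: xy(1) canonical_map_def)
    then show "on_verts canonical_map p \<in> verts (dg (UD2 \<Gamma>))"
      unfolding UD2_simps using V[OF xy(2,3)] by blast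
  next
    fix s assume "s \<in> squares ?X"
    then obtain a b where ab: "a \<in> parcs \<Gamma>1" "b \<in> parcs \<Gamma>2" and s: "s = Inl (a, b) \<or> s = Inr (b, a)"
      by (force simp: graph_cgraph_def)
    obtain u v where a: "a = (u, v)" by fastforce
    obtain x y where b: "b = (x, y)" by fastforce
    have E1: "u \<in> pverts \<Gamma>1" "v \<in> pverts \<Gamma>1" "(u, v) \<in> parcs \<Gamma>" using E[OF c(1), of u v] ab a by blast+
    have E2: "x \<in> pverts \<Gamma>2" "y \<in> pverts \<Gamma>2" "(x, y) \<in> parcs \<Gamma>" using E[OF c(2), of x y] ab b by blast+
    show "on_squares canonical_map s \<in> squares (UD2 \<Gamma>)"
      using s V[OF E1(1) E2(1)] V[OF E1(1) E2(2)] V[OF E1(2) E2(1)] V[OF E1(2) E2(2)] E1(3) E2(3)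
      by (elim disjE) (simp_all add: canonical_map_def a b)
    show "bottom (UD2 \<Gamma>) (on_squares canonical_map s) = on_edges canonical_map (bottom ?X s)"
      "on_squares canonical_map (sflip ?X s) = sflip (UD2 \<Gamma>) (on_squares canonical_map s)"
      "on_squares canonical_map (stransp ?X s) = stransp (UD2 \<Gamma>) (on_squares canonical_map s)"
      using s ab by (elim disjE; simp add: canonical_map_def a b swap_in_def)+
  qed
  have full: "t \<in> on_squares canonical_map ` corners ?X v"
    if v: "v \<in> verts (dg ?X)"
      and b: "bottom (UD2 \<Gamma>) t \<in> on_edges canonical_map ` out_arcs (dg ?X) v"
      and l: "left_side (UD2 \<Gamma>) t \<in> on_edges canonical_map ` out_arcs (dg ?X) v" for v t
  proof -
    obtain p q where pq: "v = (p, q)" "p \<in> pverts \<Gamma>1" "q \<in> pverts \<Gamma>2" using v by auto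
    obtain u w x y where t: "t = ((u, w), (x, y))" by (rule square_cases)
    have outs: "out_arcs (dg ?X) v = (\<lambda>a. Inl (a, q)) ` {a \<in> parcs \<Gamma>1. fst a = p} \<union>
        (\<lambda>b. Inr (p, b)) ` {b \<in> parcs \<Gamma>2. fst b = q}"
      using pq(2,3) by (auto simp: pq(1) out_arcs_def)
    have out: "(z, a) \<in> on_edges canonical_map ` out_arcs (dg ?X) v \<longleftrightarrow>
        z = q \<and> a \<in> parcs \<Gamma>1 \<and> fst a = p \<or> z = p \<and> a \<in> parcs \<Gamma>2 \<and> fst a = q" for z a
      unfolding outs image_Un image_image by (auto simp: canonical_map_def)
    \<comment> \<open>The bottom side of \<open>t\<close> moves \<open>u\<close> and keeps \<open>x\<close>, the left side moves \<open>x\<close> and keeps \<open>u\<close>; as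
      \<open>p \<noteq> q\<close>, the two cases below must be combined crosswise.\<close>
    have "x = q \<and> (u, w) \<in> parcs \<Gamma>1 \<and> u = p \<or> x = p \<and> (u, w) \<in> parcs \<Gamma>2 \<and> u = q"
      using b out by (simp add: t)
    moreover have "u = q \<and> (x, y) \<in> parcs \<Gamma>1 \<and> x = p \<or> u = p \<and> (x, y) \<in> parcs \<Gamma>2 \<and> x = q"
      using l out by (simp add: t left_side_def)
    ultimately have "u = p \<and> x = q \<and> (u, w) \<in> parcs \<Gamma>1 \<and> (x, y) \<in> parcs \<Gamma>2 \<or>
        u = q \<and> x = p \<and> (u, w) \<in> parcs \<Gamma>2 \<and> (x, y) \<in> parcs \<Gamma>1"
      using V(3)[OF pq(2,3)] by auto
    then have "Inl ((u, w), (x, y)) \<in> corners ?X v \<or> Inr ((u, w), (x, y)) \<in> corners ?X v"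
      using pq by (auto simp: corners_def)
    then show ?thesis
      by (force simp: t canonical_map_def)
  qed
  have "out_arcs (dg ?X) v \<subseteq> arcs (dg ?X)" "corners ?X v \<subseteq> squares ?X" for v
    by (auto simp: corners_def)
  then have "inj_on (on_edges canonical_map) (out_arcs (dg ?X) v)"
    "inj_on (on_squares canonical_map) (corners ?X v)" for v
    by (simp_all only: inj_on_subset[OF inj_on_canonical_map(1)[OF P]]
        inj_on_subset[OF inj_on_canonical_map(2)[OF P]])
  with full show ?thesis
    unfolding local_isometry_def
    using comb npc_product_complex[OF cg] npc_UD2[OF \<Gamma>] by blast
qed

lemma standard_product_subcomplex_ring_product:
  fixes \<Gamma> :: "'a pair_pre_digraph"
  assumes \<Gamma>: "pair_graph \<Gamma>" and P: "disjoint_leafless_pair \<Gamma> \<Gamma>1 \<Gamma>2"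
  shows "standard_product_subcomplex (UD2 \<Gamma>) (ring_product \<Gamma>1 \<Gamma>2)"
proof -
  let ?G = "graph_cgraph \<Gamma>1" and ?H = "graph_cgraph \<Gamma>2"
  have cg: "cube_graph ?G" "cube_graph ?H" and ll: "leafless ?G" "leafless ?H"
    using P by (auto simp: disjoint_leafless_pair_def conn_subgraph_def)
  obtain v w where vw: "v \<in> verts (dg ?G)" "w \<in> verts (dg ?H)"
    using cg unfolding cube_graph_def connected_conv by blast
  have "first_slice ?G w \<subseteq> cells (product_complex ?G ?H)"
    "second_slice v ?H \<subseteq> cells (product_complex ?G ?H)"
    using vw unfolding first_slice_def second_slice_def cells_def product_complex_simps by blast+
  then have "inj_on (on_cells canonical_map) (first_slice ?G w)"
    "inj_on (on_cells canonical_map) (second_slice v ?H)"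
    using inj_on_subset[OF inj_on_canonical_map(3)[OF P]] by blast+
  then have "standard_product_structure ?G ?H (UD2 \<Gamma>) canonical_map"
    unfolding standard_product_structure_def product_structure_def
    using cg ll vw local_isometry_canonical_map[OF \<Gamma> P] by blast
  then show ?thesis
  proof (rule standard_product_structure_retype)
    fix G' H' :: "('a uprod, 'a \<times> 'a \<times> 'a) cgraph" and \<iota>'
    assume "standard_product_structure G' H' (UD2 \<Gamma>) \<iota>'"
      and "on_cells \<iota>' ` cells (product_complex G' H') =
        on_cells canonical_map ` cells (product_complex ?G ?H)"
    then show ?thesis
      unfolding standard_product_subcomplex_def ring_product_def by - ((rule exI)+, rule conjI, assumption, erule sym)
  qed
qed

section \<open>Maps of products to the configuration space\<close>

text \<open>
  The splitting is read off from the squares.  Let \<open>\<iota>\<close> send the square \<open>e \<times> d\<close> to \<open>(A e d, B e d)\<close>, the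
  pair of arcs traversed by the two tokens.  The bottom side shows that \<open>A e d\<close> depends on \<open>d\<close> only
  through its tail, and reversing \<open>d\<close> leaves \<open>A e d\<close> unchanged; so as a function of the point of \<open>H\<close>
  it takes the same value at both ends of each arc and is constant.  Likewise \<open>B e d\<close> depends
  on \<open>d\<close> only.
\<close>

lemma combinatorial_map_UD2_splits:
  assumes G: "cube_graph G" and H: "cube_graph H"
    and \<iota>: "combinatorial_map (product_complex G H) (UD2 \<Gamma>) \<iota>"
  obtains f fa g ga where
    "\<And>x y. x \<in> verts (dg G) \<Longrightarrow> y \<in> verts (dg H) \<Longrightarrow> on_verts \<iota> (x, y) = Upair (f x) (g y)"
    "\<And>e y. e \<in> arcs (dg G) \<Longrightarrow> y \<in> verts (dg H) \<Longrightarrow> on_edges \<iota> (Inl (e, y)) = (g y, fa e)"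
    "\<And>x d. x \<in> verts (dg G) \<Longrightarrow> d \<in> arcs (dg H) \<Longrightarrow> on_edges \<iota> (Inr (x, d)) = (f x, ga d)"
    "\<And>e d. e \<in> arcs (dg G) \<Longrightarrow> d \<in> arcs (dg H) \<Longrightarrow> on_squares \<iota> (Inl (e, d)) = (fa e, ga d)"
    "\<And>e d. e \<in> arcs (dg G) \<Longrightarrow> d \<in> arcs (dg H) \<Longrightarrow> on_squares \<iota> (Inr (d, e)) = (ga d, fa e)"
    "\<And>e. e \<in> arcs (dg G) \<Longrightarrow> fa e \<in> parcs \<Gamma> \<and> fst (fa e) = f (tail (dg G) e) \<and>
      fa (erev G e) = prod.swap (fa e)"
    "\<And>d. d \<in> arcs (dg H) \<Longrightarrow> ga d \<in> parcs \<Gamma> \<and> fst (ga d) = g (tail (dg H) d) \<and>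
      ga (erev H d) = prod.swap (ga d)"
    "\<And>x y. x \<in> verts (dg G) \<Longrightarrow> y \<in> verts (dg H) \<Longrightarrow>
      f x \<in> pverts \<Gamma> \<and> g y \<in> pverts \<Gamma> \<and> f x \<noteq> g y"
proof -
  interpret G: bidirected_digraph "dg G" "erev G" using G by (simp add: cube_graph_def)
  interpret H: bidirected_digraph "dg H" "erev H" using H by (simp add: cube_graph_def)
  let ?X = "product_complex G H"
  define A where "A e d = fst (on_squares \<iota> (Inl (e, d)))" for e d
  define B where "B e d = snd (on_squares \<iota> (Inl (e, d)))" for e d
  have sqE: "on_squares \<iota> s \<in> squares (UD2 \<Gamma>)"
    "on_edges \<iota> (bottom ?X s) = bottom (UD2 \<Gamma>) (on_squares \<iota> s)"
    "on_squares \<iota> (sflip ?X s) = sflip (UD2 \<Gamma>) (on_squares \<iota> s)"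
    "on_squares \<iota> (stransp ?X s) = stransp (UD2 \<Gamma>) (on_squares \<iota> s)"
    if "s \<in> squares ?X" for s
    using \<iota> that by (auto simp: combinatorial_map_def)
  have l: "on_squares \<iota> (Inl (e, d)) = (A e d, B e d)"
    and r: "on_squares \<iota> (Inr (d, e)) = (B e d, A e d)"
    and inA: "A e d \<in> parcs \<Gamma>" and inB: "B e d \<in> parcs \<Gamma>"
    and bl: "on_edges \<iota> (Inl (e, tail (dg H) d)) = (fst (B e d), A e d)"
    and br: "on_edges \<iota> (Inr (tail (dg G) e, d)) = (fst (A e d), B e d)"
    and fl: "A (erev G e) d = prod.swap (A e d)" "B (erev G e) d = B e d"
    and fr: "A e (erev H d) = A e d" "B e (erev H d) = prod.swap (B e d)"
    if e: "e \<in> arcs (dg G)" and d: "d \<in> arcs (dg H)" for e d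
  proof -
    have R: "on_squares \<iota> (Inr (y, x)) = (B x y, A x y)" if "x \<in> arcs (dg G)" "y \<in> arcs (dg H)" for x y
    proof -
      have "Inl (x, y) \<in> squares ?X" using that by auto
      from sqE(4)[OF this] show ?thesis by (simp add: A_def B_def UD2_def prod.swap_def)
    qed
    have s: "Inl (e, d) \<in> squares ?X" "Inr (d, e) \<in> squares ?X" using e d by auto
    have L: "on_squares \<iota> (Inl (x, d)) = (A x d, B x d)" for x by (simp add: A_def B_def)
    show "on_squares \<iota> (Inl (e, d)) = (A e d, B e d)" by (rule L)
    show "on_squares \<iota> (Inr (d, e)) = (B e d, A e d)" using R e d .
    show "A e d \<in> parcs \<Gamma>" "B e d \<in> parcs \<Gamma>"
      using sqE(1)[OF s(1)] by (auto simp: L UD2_def)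
    show "on_edges \<iota> (Inl (e, tail (dg H) d)) = (fst (B e d), A e d)"
      using sqE(2)[OF s(1)] by (simp add: L UD2_def)
    show "on_edges \<iota> (Inr (tail (dg G) e, d)) = (fst (A e d), B e d)"
      using sqE(2)[OF s(2)] R[OF e d] by (simp add: UD2_def)
    show "A (erev G e) d = prod.swap (A e d)" "B (erev G e) d = B e d"
      using sqE(3)[OF s(1)] by (simp_all add: L UD2_def)
    show "A e (erev H d) = A e d" "B e (erev H d) = prod.swap (B e d)"
      using sqE(3)[OF s(2)] R[OF e d] R[OF e H.arev_in_arcs[OF d]] by (simp_all add: UD2_def)
  qed
  obtain e0 where e0: "e0 \<in> arcs (dg G)" using G by (auto simp: cube_graph_def)
  obtain d0 where d0: "d0 \<in> arcs (dg H)" using H by (auto simp: cube_graph_def)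
  define fa where "fa e = A e d0" for e
  define ga where "ga d = B e0 d" for d
  have A: "A e d = fa e" if e: "e \<in> arcs (dg G)" and d: "d \<in> arcs (dg H)" for e d
  proof -
    have inv: "snd (on_edges \<iota> (Inl (e, tail (dg H) d'))) = snd (on_edges \<iota> (Inl (e, head (dg H) d')))"
      if "d' \<in> arcs (dg H)" for d'
      using bl[OF e that] bl[OF e H.arev_in_arcs[OF that]] fr(1)[OF e that] H.tail_arev[OF that] by simp
    have "snd (on_edges \<iota> (Inl (e, tail (dg H) d))) = snd (on_edges \<iota> (Inl (e, tail (dg H) d0)))"
      by (rule connected_invariant_const[of "dg H" "\<lambda>y. snd (on_edges \<iota> (Inl (e, y)))"])
        (use H in \<open>simp_all add: cube_graph_def inv d d0\<close>)
    then show ?thesis using bl[OF e d] bl[OF e d0] by (simp add: fa_def)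
  qed
  have B: "B e d = ga d" if e: "e \<in> arcs (dg G)" and d: "d \<in> arcs (dg H)" for e d
  proof -
    have inv: "snd (on_edges \<iota> (Inr (tail (dg G) e', d))) = snd (on_edges \<iota> (Inr (head (dg G) e', d)))"
      if "e' \<in> arcs (dg G)" for e'
      using br[OF that d] br[OF G.arev_in_arcs[OF that] d] fl(2)[OF that d] G.tail_arev[OF that] by simp
    have "snd (on_edges \<iota> (Inr (tail (dg G) e, d))) = snd (on_edges \<iota> (Inr (tail (dg G) e0, d)))"
      by (rule connected_invariant_const[of "dg G" "\<lambda>x. snd (on_edges \<iota> (Inr (x, d)))"])
        (use G in \<open>simp_all add: cube_graph_def inv e e0\<close>)
    then show ?thesis using br[OF e d] br[OF e0 d] by (simp add: ga_def)
  qed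
  \<comment> \<open>The first component of an arc of the configuration space is the resting token: along
    \<open>{x} \<times> d0\<close> it is the token that belongs to \<open>G\<close>.\<close>
  define f where "f x = fst (on_edges \<iota> (Inr (x, d0)))" for x
  define g where "g y = fst (on_edges \<iota> (Inl (e0, y)))" for y
  have f: "fst (fa e) = f (tail (dg G) e)" if "e \<in> arcs (dg G)" for e
    using br[OF that d0] A[OF that d0] by (simp add: f_def)
  have g: "fst (ga d) = g (tail (dg H) d)" if "d \<in> arcs (dg H)" for d
    using bl[OF e0 that] B[OF e0 that] by (simp add: g_def)
  have el: "on_edges \<iota> (Inl (e, y)) = (g y, fa e)" if e: "e \<in> arcs (dg G)" and y: "y \<in> verts (dg H)" for e y
  proof -
    obtain d where "d \<in> arcs (dg H)" "tail (dg H) d = y" using cube_graph_vertex_has_arc[OF H y] by blast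
    then show ?thesis using bl[OF e, of d] A[OF e, of d] B[OF e, of d] g[of d] by simp
  qed
  have er: "on_edges \<iota> (Inr (x, d)) = (f x, ga d)" if x: "x \<in> verts (dg G)" and d: "d \<in> arcs (dg H)" for x d
  proof -
    obtain e where "e \<in> arcs (dg G)" "tail (dg G) e = x" using cube_graph_vertex_has_arc[OF G x] by blast
    then show ?thesis using br[OF _ d, of e] A[OF _ d, of e] B[OF _ d, of e] f[of e] by simp
  qed
  have v: "on_verts \<iota> (x, y) = Upair (f x) (g y) \<and> f x \<in> pverts \<Gamma> \<and> g y \<in> pverts \<Gamma> \<and> f x \<noteq> g y"
    if x: "x \<in> verts (dg G)" and y: "y \<in> verts (dg H)" for x y
  proof -
    obtain e where e: "e \<in> arcs (dg G)" "tail (dg G) e = x" using cube_graph_vertex_has_arc[OF G x] by blast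
    obtain p q where pq: "fa e = (p, q)" by fastforce
    have "Inl (e, y) \<in> arcs (dg ?X)" using e y by auto
    then have "tail (dg (UD2 \<Gamma>)) (on_edges \<iota> (Inl (e, y))) = on_verts \<iota> (x, y)"
      and "on_verts \<iota> (x, y) \<in> verts (dg (UD2 \<Gamma>))"
      using \<iota> e x y by (auto simp: combinatorial_map_def)
    then show ?thesis using el[OF e(1) y] f[OF e(1)] e(2) pq by auto
  qed
  show thesis
  proof (rule that[of f g fa ga])
    fix e d assume e: "e \<in> arcs (dg G)" and d: "d \<in> arcs (dg H)"
    show "on_squares \<iota> (Inl (e, d)) = (fa e, ga d)" "on_squares \<iota> (Inr (d, e)) = (ga d, fa e)"
      using l[OF e d] r[OF e d] A[OF e d] B[OF e d] by simp_all
  next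
    fix e assume e: "e \<in> arcs (dg G)"
    show "fa e \<in> parcs \<Gamma> \<and> fst (fa e) = f (tail (dg G) e) \<and> fa (erev G e) = prod.swap (fa e)"
      using inA[OF e d0] f[OF e] fl(1)[OF e d0] by (simp add: fa_def)
  next
    fix d assume d: "d \<in> arcs (dg H)"
    show "ga d \<in> parcs \<Gamma> \<and> fst (ga d) = g (tail (dg H) d) \<and> ga (erev H d) = prod.swap (ga d)"
      using inB[OF e0 d] g[OF d] fr(2)[OF e0 d] by (simp add: ga_def)
  qed (use v el er in blast)+
qed

text \<open>
  The injective graph map \<open>f\<close> is an isomorphism onto its image, which inherits connectedness and all
  valencies.
\<close>

lemma embedded_graph_conn_subgraph:
  fixes \<Gamma> :: "'a pair_pre_digraph"
  assumes \<Gamma>: "pair_graph \<Gamma>" and G: "cube_graph G" "leafless G"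
    and inj: "inj_on f (verts (dg G))" "inj_on fa (arcs (dg G))"
    and v: "\<And>x. x \<in> verts (dg G) \<Longrightarrow> f x \<in> pverts \<Gamma>"
    and a: "\<And>e. e \<in> arcs (dg G) \<Longrightarrow> fa e \<in> parcs \<Gamma> \<and> fst (fa e) = f (tail (dg G) e) \<and>
      fa (erev G e) = prod.swap (fa e)"
  defines "\<Delta> \<equiv> \<lparr>pverts = f ` verts (dg G), parcs = fa ` arcs (dg G)\<rparr>"
  shows "conn_subgraph \<Delta> \<Gamma>" "leafless (graph_cgraph \<Delta>)" "cgraph_iso G (graph_cgraph \<Delta>) f fa"
proof -
  interpret pair_graph \<Gamma> by fact
  interpret G: bidirected_digraph "dg G" "erev G" using G by (simp add: cube_graph_def)
  define hom where "hom = \<lparr>iso_verts = f, iso_arcs = fa, iso_head = snd, iso_tail = fst\<rparr>"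
  have s: "snd (fa e) = f (head (dg G) e)" if "e \<in> arcs (dg G)" for e
    using a[of "erev G e"] a[OF that] that by auto
  have hom: "G.digraph_isomorphism hom"
    using inj a s G.wf_digraph by (simp add: G.digraph_isomorphism_def hom_def)
  have app: "with_proj \<Delta> = app_iso hom (dg G)"
    by (simp add: with_proj_def app_iso_def hom_def \<Delta>_def)
  have sw: "swap_in (parcs \<Delta>) (fa e) = fa (erev G e)" if "e \<in> arcs (dg G)" for e
    using that a by (simp add: swap_in_def \<Delta>_def)
  have wf: "wf_digraph (with_proj \<Delta>)"
    unfolding app by (rule G.wf_digraphI_app_iso[OF hom])
  have "bidirected_digraph (with_proj \<Delta>) (swap_in (parcs \<Delta>))"
  proof (rule wf_digraph.bidirected_digraphI[OF wf])
    fix b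
    show "swap_in (parcs \<Delta>) b = b" if "b \<notin> arcs (with_proj \<Delta>)"
      using that by (simp add: swap_in_def)
    assume "b \<in> arcs (with_proj \<Delta>)"
    then obtain e where e: "b = fa e" "e \<in> arcs (dg G)" by (auto simp: \<Delta>_def)
    then show "swap_in (parcs \<Delta>) (swap_in (parcs \<Delta>) b) = b" by (simp add: sw)
    show "swap_in (parcs \<Delta>) b \<noteq> b"
      using e inj_onD[OF inj(2), of "erev G e" e] G.arev_neq[of e] sw[of e] by auto
    show "tail (with_proj \<Delta>) (swap_in (parcs \<Delta>) b) = head (with_proj \<Delta>) b"
      using e s[of e] sw[of e] a[of "erev G e"] by (metis G.arev_in_arcs G.tail_arev with_proj_simps(4,5))
  qed
  moreover have "connected (with_proj \<Delta>)"
    unfolding app using G(1) G.connectedI_app_iso[OF _ hom] by (simp add: cube_graph_def)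
  moreover have "parcs \<Delta> \<noteq> {}" using G(1) by (simp add: \<Delta>_def cube_graph_def)
  ultimately have "cube_graph (graph_cgraph \<Delta>)" by (simp add: cube_graph_def)
  moreover have "subgraph (with_proj \<Delta>) (with_proj \<Gamma>)"
    using wf wf_digraph v a by (auto simp: subgraph_def \<Delta>_def)
  ultimately show "conn_subgraph \<Delta> \<Gamma>" by (simp add: conn_subgraph_def)
  have "out_degree (with_proj \<Delta>) (f x) = out_degree (dg G) x" if "x \<in> verts (dg G)" for x
    unfolding app using G.out_degree_app_iso_eq[OF hom that] by (simp add: hom_def)
  then show "leafless (graph_cgraph \<Delta>)"
    using G(2) by (simp add: leafless_def) (simp add: \<Delta>_def)
  show "cgraph_iso G (graph_cgraph \<Delta>) f fa"
    using inj a sw by (auto simp: cgraph_iso_def bij_betw_def \<Delta>_def)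
qed

text \<open>
  Both the description of the image and the injectivity come from the factorisation of \<open>\<iota>\<close> as an
  isomorphism \<open>G \<times> H \<rightarrow> \<Gamma>1 \<times> \<Gamma>2\<close> followed by the canonical map.
\<close>

lemma standard_product_structure_UD2:
  assumes \<Gamma>: "pair_graph \<Gamma>" and st: "standard_product_structure G H (UD2 \<Gamma>) \<iota>"
  obtains \<Gamma>1 \<Gamma>2 where "disjoint_leafless_pair \<Gamma> \<Gamma>1 \<Gamma>2"
    "on_cells \<iota> ` cells (product_complex G H) = ring_product \<Gamma>1 \<Gamma>2"
    "inj_on (on_cells \<iota>) (cells (product_complex G H))"
proof -
  have G: "cube_graph G" "leafless G" and H: "cube_graph H" "leafless H"
    and comb: "combinatorial_map (product_complex G H) (UD2 \<Gamma>) \<iota>"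
    using st by (auto simp: standard_product_structure_def product_structure_def local_isometry_def)
  obtain v w where vw: "v \<in> verts (dg G)" "w \<in> verts (dg H)"
    and i1: "inj_on (on_cells \<iota>) (first_slice G w)"
    and i2: "inj_on (on_cells \<iota>) (second_slice v H)"
    using st by (auto simp: standard_product_structure_def product_structure_def)
  obtain f fa g ga where
    verts: "\<And>x y. x \<in> verts (dg G) \<Longrightarrow> y \<in> verts (dg H) \<Longrightarrow> on_verts \<iota> (x, y) = Upair (f x) (g y)"
    and el: "\<And>e y. e \<in> arcs (dg G) \<Longrightarrow> y \<in> verts (dg H) \<Longrightarrow> on_edges \<iota> (Inl (e, y)) = (g y, fa e)"
    and er: "\<And>x d. x \<in> verts (dg G) \<Longrightarrow> d \<in> arcs (dg H) \<Longrightarrow> on_edges \<iota> (Inr (x, d)) = (f x, ga d)"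
    and sl: "\<And>e d. e \<in> arcs (dg G) \<Longrightarrow> d \<in> arcs (dg H) \<Longrightarrow> on_squares \<iota> (Inl (e, d)) = (fa e, ga d)"
    and sr: "\<And>e d. e \<in> arcs (dg G) \<Longrightarrow> d \<in> arcs (dg H) \<Longrightarrow> on_squares \<iota> (Inr (d, e)) = (ga d, fa e)"
    and fa: "\<And>e. e \<in> arcs (dg G) \<Longrightarrow> fa e \<in> parcs \<Gamma> \<and> fst (fa e) = f (tail (dg G) e) \<and>
      fa (erev G e) = prod.swap (fa e)"
    and ga: "\<And>d. d \<in> arcs (dg H) \<Longrightarrow> ga d \<in> parcs \<Gamma> \<and> fst (ga d) = g (tail (dg H) d) \<and>
      ga (erev H d) = prod.swap (ga d)"
    and fg: "\<And>x y. x \<in> verts (dg G) \<Longrightarrow> y \<in> verts (dg H) \<Longrightarrow>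
      f x \<in> pverts \<Gamma> \<and> g y \<in> pverts \<Gamma> \<and> f x \<noteq> g y"
    by (rule combinatorial_map_UD2_splits[OF G(1) H(1) comb]) (rule that; assumption)
  have injf: "inj_on f (verts (dg G))" "inj_on fa (arcs (dg G))"
  proof -
    show "inj_on f (verts (dg G))"
    proof (rule inj_onI)
      fix x y assume xy: "x \<in> verts (dg G)" "y \<in> verts (dg G)" "f x = f y"
      then have eq: "on_cells \<iota> (Vertex (x, w)) = on_cells \<iota> (Vertex (y, w))"
        using vw by (simp add: verts)
      show "x = y" using inj_onD[OF i1 eq] xy(1,2) by (simp add: first_slice_def image_iff)
    qed
    show "inj_on fa (arcs (dg G))"
    proof (rule inj_onI)
      fix d e assume de: "d \<in> arcs (dg G)" "e \<in> arcs (dg G)" "fa d = fa e"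
      then have eq: "on_cells \<iota> (Edge (Inl (d, w))) = on_cells \<iota> (Edge (Inl (e, w)))"
        using vw by (simp add: el)
      show "d = e" using inj_onD[OF i1 eq] de(1,2) by (simp add: first_slice_def image_iff)
    qed
  qed
  have injg: "inj_on g (verts (dg H))" "inj_on ga (arcs (dg H))"
  proof -
    show "inj_on g (verts (dg H))"
    proof (rule inj_onI)
      fix x y assume xy: "x \<in> verts (dg H)" "y \<in> verts (dg H)" "g x = g y"
      then have eq: "on_cells \<iota> (Vertex (v, x)) = on_cells \<iota> (Vertex (v, y))"
        using vw by (simp add: verts)
      show "x = y" using inj_onD[OF i2 eq] xy(1,2) by (simp add: second_slice_def image_iff)
    qed
    show "inj_on ga (arcs (dg H))"
    proof (rule inj_onI)
      fix d e assume de: "d \<in> arcs (dg H)" "e \<in> arcs (dg H)" "ga d = ga e"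
      then have eq: "on_cells \<iota> (Edge (Inr (v, d))) = on_cells \<iota> (Edge (Inr (v, e)))"
        using vw by (simp add: er)
      show "d = e" using inj_onD[OF i2 eq] de(1,2) by (simp add: second_slice_def image_iff)
    qed
  qed
  define \<Gamma>1 where "\<Gamma>1 = \<lparr>pverts = f ` verts (dg G), parcs = fa ` arcs (dg G)\<rparr>"
  define \<Gamma>2 where "\<Gamma>2 = \<lparr>pverts = g ` verts (dg H), parcs = ga ` arcs (dg H)\<rparr>"
  have fV: "f x \<in> pverts \<Gamma>" if "x \<in> verts (dg G)" for x using fg[OF that vw(2)] by blast
  have gV: "g y \<in> pverts \<Gamma>" if "y \<in> verts (dg H)" for y using fg[OF vw(1) that] by blast
  have 1: "conn_subgraph \<Gamma>1 \<Gamma>" "leafless (graph_cgraph \<Gamma>1)" "cgraph_iso G (graph_cgraph \<Gamma>1) f fa"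
    unfolding \<Gamma>1_def by (rule embedded_graph_conn_subgraph[OF \<Gamma> G injf fV fa]; assumption)+
  have 2: "conn_subgraph \<Gamma>2 \<Gamma>" "leafless (graph_cgraph \<Gamma>2)" "cgraph_iso H (graph_cgraph \<Gamma>2) g ga"
    unfolding \<Gamma>2_def by (rule embedded_graph_conn_subgraph[OF \<Gamma> H injg gV ga]; assumption)+
  \<comment> \<open>Disjointness holds because \<open>{f x, g y}\<close> is a vertex of the configuration space for all \<open>x\<close>, \<open>y\<close>.\<close>
  have P: "disjoint_leafless_pair \<Gamma> \<Gamma>1 \<Gamma>2"
    unfolding disjoint_leafless_pair_def
  proof (intro conjI 1(1,2) 2(1,2))
    show "pverts \<Gamma>1 \<inter> pverts \<Gamma>2 = {}" using fg by (auto simp: \<Gamma>1_def \<Gamma>2_def)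
  qed
  let ?\<psi> = "product_map f fa g ga"
  have bij: "bij_betw (on_cells ?\<psi>) (cells (product_complex G H))
      (cells (product_complex (graph_cgraph \<Gamma>1) (graph_cgraph \<Gamma>2)))"
    by (intro sqcomplex_iso_cells sqcomplex_iso_product_map G(1) H(1) 1(3) 2(3))
  have eq: "on_cells \<iota> c = (on_cells canonical_map \<circ> on_cells ?\<psi>) c"
    if "c \<in> cells (product_complex G H)" for c
  proof -
    from that consider x y where "c = Vertex (x, y)" "x \<in> verts (dg G)" "y \<in> verts (dg H)"
      | e y where "c = Edge (Inl (e, y))" "e \<in> arcs (dg G)" "y \<in> verts (dg H)"
      | x d where "c = Edge (Inr (x, d))" "x \<in> verts (dg G)" "d \<in> arcs (dg H)"
      | e d where "c = Square (Inl (e, d))" "e \<in> arcs (dg G)" "d \<in> arcs (dg H)"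
      | e d where "c = Square (Inr (d, e))" "e \<in> arcs (dg G)" "d \<in> arcs (dg H)"
      unfolding cells_def product_complex_simps by blast
    then show ?thesis
      by cases (simp_all add: canonical_map_def product_map_def verts el er sl sr)
  qed
  have "on_cells \<iota> ` cells (product_complex G H)
      = (on_cells canonical_map \<circ> on_cells ?\<psi>) ` cells (product_complex G H)"
    by (rule image_cong[OF refl eq])
  then have im: "on_cells \<iota> ` cells (product_complex G H) = ring_product \<Gamma>1 \<Gamma>2"
    unfolding ring_product_def using bij_betw_imp_surj_on[OF bij] by (metis image_comp)
  have "inj_on (on_cells canonical_map \<circ> on_cells ?\<psi>) (cells (product_complex G H))"
    using inj_on_canonical_map(3)[OF P] bij_betw_imp_surj_on[OF bij]
    by (intro comp_inj_on bij_betw_imp_inj_on[OF bij]) simp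
  moreover have "inj_on (on_cells \<iota>) (cells (product_complex G H)) \<longleftrightarrow>
      inj_on (on_cells canonical_map \<circ> on_cells ?\<psi>) (cells (product_complex G H))"
    by (rule inj_on_cong) (rule eq)
  ultimately have "inj_on (on_cells \<iota>) (cells (product_complex G H))" by blast
  with P im show thesis by (rule that)
qed

section \<open>Standard and maximal product subcomplexes\<close>

lemma standard_product_subcomplex_UD2_iff:
  fixes \<Gamma> :: "'a pair_pre_digraph"
  assumes "pair_graph \<Gamma>"
  shows "standard_product_subcomplex (UD2 \<Gamma>) K \<longleftrightarrow>
    (\<exists>\<Gamma>1 \<Gamma>2. disjoint_leafless_pair \<Gamma> \<Gamma>1 \<Gamma>2 \<and> K = ring_product \<Gamma>1 \<Gamma>2)"
proof
  assume "standard_product_subcomplex (UD2 \<Gamma>) K"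
  then obtain G H :: "('a uprod, 'a \<times> 'a \<times> 'a) cgraph" and \<iota> where st: "standard_product_structure G H (UD2 \<Gamma>) \<iota>"
    and K: "K = on_cells \<iota> ` cells (product_complex G H)"
    unfolding standard_product_subcomplex_def by blast
  obtain \<Gamma>1 \<Gamma>2 where "disjoint_leafless_pair \<Gamma> \<Gamma>1 \<Gamma>2"
    and "on_cells \<iota> ` cells (product_complex G H) = ring_product \<Gamma>1 \<Gamma>2"
    by (rule standard_product_structure_UD2[OF assms st])
  then show "\<exists>\<Gamma>1 \<Gamma>2. disjoint_leafless_pair \<Gamma> \<Gamma>1 \<Gamma>2 \<and> K = ring_product \<Gamma>1 \<Gamma>2"
    unfolding K by blast
next
  assume "\<exists>\<Gamma>1 \<Gamma>2. disjoint_leafless_pair \<Gamma> \<Gamma>1 \<Gamma>2 \<and> K = ring_product \<Gamma>1 \<Gamma>2"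
  then show "standard_product_subcomplex (UD2 \<Gamma>) K"
    using standard_product_subcomplex_ring_product[OF assms] by blast
qed

text \<open>
  A product containing \<open>\<Gamma>1 \<times> \<Gamma>2\<close> may have its factors listed in the other order; exchanging them
  yields a pair of larger subgraphs, to which the right-hand side applies.
\<close>

lemma maximal_product_subcomplex_ring_product_iff:
  assumes \<Gamma>: "pair_graph \<Gamma>" and P: "disjoint_leafless_pair \<Gamma> \<Gamma>1 \<Gamma>2"
  shows "maximal_product_subcomplex (UD2 \<Gamma>) (ring_product \<Gamma>1 \<Gamma>2) \<longleftrightarrow>
    \<not> (\<exists>\<Gamma>1' \<Gamma>2'. disjoint_leafless_pair \<Gamma> \<Gamma>1' \<Gamma>2' \<and>
      subgraph (with_proj \<Gamma>1) (with_proj \<Gamma>1') \<and> subgraph (with_proj \<Gamma>2) (with_proj \<Gamma>2') \<and>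
      (\<Gamma>1 \<noteq> \<Gamma>1' \<or> \<Gamma>2 \<noteq> \<Gamma>2'))" (is "?M \<longleftrightarrow> \<not> ?E")
proof
  assume M: ?M
  show "\<not> ?E"
  proof
    assume ?E
    then obtain \<Gamma>1' \<Gamma>2' where P': "disjoint_leafless_pair \<Gamma> \<Gamma>1' \<Gamma>2'"
      and s: "subgraph (with_proj \<Gamma>1) (with_proj \<Gamma>1')" "subgraph (with_proj \<Gamma>2) (with_proj \<Gamma>2')"
      and ne: "\<Gamma>1 \<noteq> \<Gamma>1' \<or> \<Gamma>2 \<noteq> \<Gamma>2'" by blast
    have "ring_product \<Gamma>1 \<Gamma>2 \<subseteq> ring_product \<Gamma>1' \<Gamma>2'"
      using s by (intro ring_product_mono) (auto simp: subgraph_def)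
    then have "ring_product \<Gamma>1' \<Gamma>2' = ring_product \<Gamma>1 \<Gamma>2"
      using M standard_product_subcomplex_ring_product[OF \<Gamma> P']
      by (simp add: maximal_product_subcomplex_def)
    then show False using ring_product_inject[OF P P' s] ne by blast
  qed
next
  assume E: "\<not> ?E"
  have "K' = ring_product \<Gamma>1 \<Gamma>2"
    if std: "standard_product_subcomplex (UD2 \<Gamma>) K'" and sub: "ring_product \<Gamma>1 \<Gamma>2 \<subseteq> K'" for K'
  proof -
    obtain \<Gamma>1' \<Gamma>2' where P': "disjoint_leafless_pair \<Gamma> \<Gamma>1' \<Gamma>2'" and K': "K' = ring_product \<Gamma>1' \<Gamma>2'"
      using std standard_product_subcomplex_UD2_iff[OF \<Gamma>] by blast
    from ring_product_subset_cases[OF P P' sub[unfolded K']]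
    consider "\<Gamma>1 = \<Gamma>1' \<and> \<Gamma>2 = \<Gamma>2'" | "\<Gamma>1 = \<Gamma>2' \<and> \<Gamma>2 = \<Gamma>1'"
      using E P' disjoint_leafless_pair_commute[OF P'] by blast
    then show ?thesis
      by cases (simp_all add: K' ring_product_commute)
  qed
  then show ?M
    unfolding maximal_product_subcomplex_def
    using standard_product_subcomplex_ring_product[OF \<Gamma> P] by blast
qed

theorem proposition1p4:
  fixes \<Gamma> :: "'a pair_pre_digraph"
  assumes "pair_graph \<Gamma>"
    and "connected (with_proj \<Gamma>)"
    and "parcs \<Gamma> \<noteq> {}"
  shows "(\<forall>K. subcomplex K (UD2 \<Gamma>) \<longrightarrow>
            (standard_product_subcomplex (UD2 \<Gamma>) K \<longleftrightarrow>
              (\<exists>\<Gamma>1 \<Gamma>2. disjoint_leafless_pair \<Gamma> \<Gamma>1 \<Gamma>2 \<and> K = ring_product \<Gamma>1 \<Gamma>2))) \<and>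
         (\<forall>K. standard_product_subcomplex (UD2 \<Gamma>) K \<longrightarrow> embedded_product_subcomplex (UD2 \<Gamma>) K) \<and>
         (\<forall>K. subcomplex K (UD2 \<Gamma>) \<longrightarrow>
            (maximal_product_subcomplex (UD2 \<Gamma>) K \<longleftrightarrow>
              standard_product_subcomplex (UD2 \<Gamma>) K \<and>
              (\<exists>\<Gamma>1 \<Gamma>2. disjoint_leafless_pair \<Gamma> \<Gamma>1 \<Gamma>2 \<and> K = ring_product \<Gamma>1 \<Gamma>2 \<and>
                \<not> (\<exists>\<Gamma>1' \<Gamma>2'. disjoint_leafless_pair \<Gamma> \<Gamma>1' \<Gamma>2' \<and>
                      subgraph (with_proj \<Gamma>1) (with_proj \<Gamma>1') \<and>
                      subgraph (with_proj \<Gamma>2) (with_proj \<Gamma>2') \<and>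
                      (\<Gamma>1 \<noteq> \<Gamma>1' \<or> \<Gamma>2 \<noteq> \<Gamma>2')))))"
proof (intro conjI allI impI)
  fix K
  show "standard_product_subcomplex (UD2 \<Gamma>) K \<longleftrightarrow>
      (\<exists>\<Gamma>1 \<Gamma>2. disjoint_leafless_pair \<Gamma> \<Gamma>1 \<Gamma>2 \<and> K = ring_product \<Gamma>1 \<Gamma>2)"
    by (rule standard_product_subcomplex_UD2_iff[OF assms(1)])
  show "embedded_product_subcomplex (UD2 \<Gamma>) K" if "standard_product_subcomplex (UD2 \<Gamma>) K"
    unfolding embedded_product_subcomplex_def
  proof (intro conjI allI impI, fact that, elim conjE)
    fix G H :: "('a uprod, 'a \<times> 'a \<times> 'a) cgraph" and \<iota>
    assume "standard_product_structure G H (UD2 \<Gamma>) \<iota>"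
    then show "inj_on (on_cells \<iota>) (cells (product_complex G H))"
      by (rule standard_product_structure_UD2[OF assms(1)])
  qed
  show "maximal_product_subcomplex (UD2 \<Gamma>) K \<longleftrightarrow>
      standard_product_subcomplex (UD2 \<Gamma>) K \<and>
      (\<exists>\<Gamma>1 \<Gamma>2. disjoint_leafless_pair \<Gamma> \<Gamma>1 \<Gamma>2 \<and> K = ring_product \<Gamma>1 \<Gamma>2 \<and>
        \<not> (\<exists>\<Gamma>1' \<Gamma>2'. disjoint_leafless_pair \<Gamma> \<Gamma>1' \<Gamma>2' \<and>
              subgraph (with_proj \<Gamma>1) (with_proj \<Gamma>1') \<and>
              subgraph (with_proj \<Gamma>2) (with_proj \<Gamma>2') \<and>
              (\<Gamma>1 \<noteq> \<Gamma>1' \<or> \<Gamma>2 \<noteq> \<Gamma>2')))"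
    (is "_ \<longleftrightarrow> ?R")
  proof
    assume M: "maximal_product_subcomplex (UD2 \<Gamma>) K"
    then have S: "standard_product_subcomplex (UD2 \<Gamma>) K"
      by (simp add: maximal_product_subcomplex_def)
    then obtain \<Gamma>1 \<Gamma>2 where P: "disjoint_leafless_pair \<Gamma> \<Gamma>1 \<Gamma>2" and K: "K = ring_product \<Gamma>1 \<Gamma>2"
      using standard_product_subcomplex_UD2_iff[OF assms(1)] by blast
    then show ?R
      using S M maximal_product_subcomplex_ring_product_iff[OF assms(1) P] by blast
  next
    assume ?R
    then show "maximal_product_subcomplex (UD2 \<Gamma>) K"
      using maximal_product_subcomplex_ring_product_iff[OF assms(1)] by blast
  qed
qed

end
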